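(* Let $\mathcal T$ be a tiling of the plane with equilateral triangles such that the side lengths of the triangles are bounded from below by a positive constant and no two triangles of $\mathcal T$ share a side. Then the triangles in $\mathcal T$ have at most three different side lengths $a$, $b$ and $c$ with $a=b+c$ (where $c$ may be equal to $b$), and the tiling $\mathcal T$ is periodic.
   Context: A collection of compact convex sets with nonempty interiors tiles a region $R$ if no two of them share an interior point and their union is $R$. "No two triangles share a side" means that no segment is a full side of two different triangles of the tiling. A tiling of the plane is periodic if it is mapped onto itself by translations along two linearly independent vectors. *)

theory Defs
  imports "HOL-Analysis.Analysis"
begin

definition tiles :: "(real^2) set set \<Rightarrow> (real^2) set \<Rightarrow> bool" where
  "tiles \<T> R \<longleftrightarrow>
     (\<forall>T\<in>\<T>. compact T \<and> convex T \<and> interior T \<noteq> {}) \<and>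
     pairwise (\<lambda>S T. interior S \<inter> interior T = {}) \<T> \<and>
     \<Union>\<T> = R"

definition equilateral_triangle :: "(real^2) set \<Rightarrow> bool" where
  "equilateral_triangle T \<longleftrightarrow>
     (\<exists>p q r. p \<noteq> q \<and> dist p q = dist q r \<and> dist q r = dist r p \<and> T = convex hull {p, q, r})"

text \<open>The full sides of a triangle are its one-dimensional faces, expressed by \<^const>\<open>edge_of\<close>.\<close>

definition side_lengths :: "(real^2) set set \<Rightarrow> real set" where
  "side_lengths \<T> = {dist p q | p q T. T \<in> \<T> \<and> closed_segment p q edge_of T}"

definition share_side :: "(real^2) set \<Rightarrow> (real^2) set \<Rightarrow> bool" where
  "share_side S T \<longleftrightarrow> (\<exists>e. e edge_of S \<and> e edge_of T)"

definition periodic :: "(real^2) set set \<Rightarrow> bool" where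
  "periodic \<T> \<longleftrightarrow>
     (\<exists>u v. u \<noteq> v \<and> independent {u, v} \<and>
        (\<lambda>T. (+) u ` T) ` \<T> = \<T> \<and> (\<lambda>T. (+) v ` T) ` \<T> = \<T>)"

end

theory Submission
  imports Defs
begin

text \<open>All triangles have parallel sides, and at every vertex one finds either six corners or
  three corners facing the relative interior of a side. Two corners adjacent at a vertex have different
  sizes. If the middle one of three consecutive corners is not the largest, looking at the tiles around
  it produces a tile in the same situation that is smaller by at least the lower bound \<open>\<delta>\<close> on the
  sizes; this cannot go on forever. So the middle corner is always the largest, which rules out six
  corners at a vertex and splits the tiles into large ones (in the middle at each vertex) and small
  ones (at the end at each vertex). Each side of a large tile is met by exactly two small tiles, so
  its length is the sum of their two sizes.

  Consequently the size of a large tile is the average of the sizes of the three large tiles on whose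
  sides its corners lie. Stepping to these three neighbours gives three commuting maps with trivial
  composition, so the size is a positive harmonic function for a centred walk on an orbit of
  \<open>\<int> \<times> \<int>\<close>, hence constant. Then all sizes are constant along the orbit, whose tiles
  are permuted by two independent translations; by connectedness the orbit contains every tile.\<close>

section \<open>Positive harmonic functions\<close>

text \<open>Sizes are bounded from below only. A largest tile need not exist a priori, so the
  averaging relation cannot be settled by a maximum principle; it takes a Liouville theorem for
  positive, possibly unbounded functions, obtained here from the ratios of the function at
  neighbouring points. The three neighbour maps cannot be seen to commute from their effect on the
  plane, because their displacements depend on sizes not yet known to be constant. Commutation comes
  from paths that close up: going round a large tile, round the small tile clockwise of a corner,
  and round the small tile counterclockwise of it each take three steps. These are the relations
  \<open>R^3 = F^3 = (R F)^3 = 1\<close>, in which no size appears. The combinatorial part knows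
  only the six sectors at a vertex, so that the descent applies to the reversed numbering as well.
  Besides the descent, the lower bound on sizes yields local finiteness by packing, and with it the
  connectedness argument.\<close>

lemma add_two_div_sqrt_gt_three:
  fixes r :: real
  assumes "r > 1"
  shows "r + 2 / sqrt r > 3"
proof -
  define s where "s = sqrt r"
  have s: "s > 1" "r = s^2" using assms by (auto simp: s_def)
  \<comment> \<open>The product is \<open>s^3 - 3 * s + 2\<close>; the double root at 1 is what
    makes the excess positive for every \<open>r > 1\<close>.\<close>
  have "(s - 1)^2 * (s + 2) > 0" using s by simp
  then have "s^3 - 3 * s + 2 > 0" by (simp add: power2_eq_square power3_eq_cube algebra_simps)
  moreover have "r + 2 / sqrt r - 3 = (s^3 - 3 * s + 2) / s"
    using s by (simp add: field_simps power2_eq_square power3_eq_cube)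
  ultimately show ?thesis using s by (smt (verit) divide_pos_pos)
qed

text \<open>Near a point where \<open>f (a q) / f q\<close> almost attains its supremum \<open>r\<close>, the ratio stays almost \<open>r\<close>
  along the powers of \<open>b\<close>, where \<open>f\<close> therefore almost satisfies
  \<open>f (b (b q)) = (3 - r) * f (b q) - f q / r\<close>. For \<open>r > 1\<close> the roots of this recurrence are not
  positive reals, so no positive sequence satisfies it for long.\<close>

lemma harmonic_no_growth:
  fixes f :: "'q \<Rightarrow> real"
  assumes maps: "\<And>q. q \<in> Q \<Longrightarrow> a q \<in> Q" "\<And>q. q \<in> Q \<Longrightarrow> b q \<in> Q" "\<And>q. q \<in> Q \<Longrightarrow> c q \<in> Q"
    and pos: "\<And>q. q \<in> Q \<Longrightarrow> f q > 0"
    and harm: "\<And>q. q \<in> Q \<Longrightarrow> 3 * f q = f (a q) + f (b q) + f (c q)"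
    and comm: "\<And>q. q \<in> Q \<Longrightarrow> a (b q) = b (a q)" "\<And>q. q \<in> Q \<Longrightarrow> a (c q) = c (a q)"
      "\<And>q. q \<in> Q \<Longrightarrow> b (c q) = c (b q)"
    and prod: "\<And>q. q \<in> Q \<Longrightarrow> a (b (c q)) = q"
    and q: "q \<in> Q"
  shows "f (a q) \<le> f q"
proof -
  have le3: "f (a z) \<le> 3 * f z" "f (b z) \<le> 3 * f z" "f (c z) \<le> 3 * f z" if "z \<in> Q" for z
    using harm[OF that] pos[OF maps(1)[OF that]] pos[OF maps(2)[OF that]] pos[OF maps(3)[OF that]]
    by auto
  define r where "r = (SUP z\<in>Q. f (a z) / f z)"
  have bdd: "bdd_above ((\<lambda>z. f (a z) / f z) ` Q)"
    using le3(1) pos by (auto intro!: bdd_aboveI[of _ 3] simp: divide_le_eq)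
  have up: "f (a z) \<le> r * f z" if "z \<in> Q" for z
    using cSUP_upper[OF that bdd] pos[OF that] by (simp add: r_def divide_le_eq)
  have "r \<le> 1"
  proof (rule ccontr)
    assume "\<not> r \<le> 1"
    then have r: "r > 1" by simp
    \<comment> \<open>For every ratio \<open>t > 0\<close> the value
      \<open>3 - r - 1 / (r * t)\<close> lies below \<open>t\<close> by at least
      \<open>\<kappa>\<close>. One half of this drop is spent on error terms.\<close>
    define \<kappa> where "\<kappa> = r + 2 / sqrt r - 3"
    have \<kappa>: "\<kappa> > 0" using add_two_div_sqrt_gt_three[OF r] by (simp add: \<kappa>_def)
    \<comment> \<open>Losing \<open>\<kappa> / 2\<close> in each of \<open>N\<close> steps uses up
      more than 3, the largest possible first ratio.\<close>
    obtain N :: nat where N: "real N > 6 / \<kappa>" using reals_Archimedean2 by blast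
    \<comment> \<open>Per step the bound on the error \<open>g\<close> grows by a factor 3 and
      \<open>f\<close> shrinks at most by a factor 9. The relative error thus grows by at most 27
      and stays below \<open>\<kappa> / 2\<close> for \<open>N\<close> steps.\<close>
    define \<epsilon> where "\<epsilon> = \<kappa> / 2 / 27 ^ N"
    have \<epsilon>: "\<epsilon> > 0" using \<kappa> by (simp add: \<epsilon>_def)
    have "\<exists>p\<in>Q. f (a p) / f p > r - \<epsilon>"
      using less_cSUP_iff[OF _ bdd, of "r - \<epsilon>"] q \<epsilon> by (auto simp: r_def)
    then obtain p where p: "p \<in> Q" "f (a p) / f p > r - \<epsilon>" by blast
    \<comment> \<open>The defect of \<open>r\<close> from being attained is nonnegative and, as
      \<open>a\<close> commutes with the other maps, harmonic again. Hence its smallness at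
      \<open>p\<close> carries over to the points \<open>w n\<close>.\<close>
    define g where "g z = r * f z - f (a z)" for z
    define w where "w n = (b ^^ n) p" for n
    have w: "w n \<in> Q" for n by (induction n) (use p maps(2) in \<open>auto simp: w_def\<close>)
    have wS: "w (Suc n) = b (w n)" for n by (simp add: w_def)
    have g0: "g z \<ge> 0" if "z \<in> Q" for z using up[OF that] by (simp add: g_def)
    have gharm: "3 * g z = g (a z) + g (b z) + g (c z)" if "z \<in> Q" for z
      using harm[OF that] harm[OF maps(1)[OF that]] comm(1,2)[OF that]
      by (simp add: g_def algebra_simps)
    have gb: "g (b z) \<le> 3 * g z" "g (c z) \<le> 3 * g z" if "z \<in> Q" for z
      using gharm[OF that] g0[OF maps(1)[OF that]] g0[OF maps(2)[OF that]] g0[OF maps(3)[OF that]]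
      by auto
    have gw: "g (w n) \<le> 3 ^ n * (\<epsilon> * f p)" for n
    proof (induction n)
      case 0
      show ?case using p(2) pos[OF p(1)] by (simp add: g_def w_def field_simps)
    next
      case (Suc n)
      show ?case using gb(1)[OF w[of n]] Suc by (simp add: wS)
    qed
    \<comment> \<open>Applying \<open>a\<close> and then \<open>c\<close> leads from
      \<open>b z\<close> back to \<open>z\<close>, so two growth bounds limit the decay under
      \<open>b\<close>.\<close>
    have fback: "f z \<le> 9 * f (b z)" if z: "z \<in> Q" for z
    proof -
      have "z = c (a (b z))" using prod[OF z] comm z maps by metis
      then show ?thesis using le3(3)[of "a (b z)"] le3(1)[of "b z"] z maps by simp
    qed
    have fw: "f p \<le> 9 ^ n * f (w n)" for n
    proof (induction n)
      case 0 then show ?case by (simp add: w_def)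
    next
      case (Suc n)
      have "9 ^ n * f (w n) \<le> 9 ^ n * (9 * f (w (Suc n)))"
        unfolding wS by (intro mult_left_mono fback w) auto
      from order_trans[OF Suc this] show ?case by (simp add: mult_ac)
    qed
    have rec: "f (w (Suc (Suc n))) \<le> (3 - r) * f (w (Suc n)) - f (w n) / r + g (w (Suc n))" for n
    proof -
      \<comment> \<open>\<open>a\<close> takes this point back to \<open>w n\<close>, so the
        supremum \<open>r\<close> bounds \<open>f z\<close> from below.\<close>
      define z where "z = c (w (Suc n))"
      have z: "z \<in> Q" by (simp add: z_def maps w)
      have "a z = w n" using prod[OF w[of n]] comm(3)[OF w[of n]] by (simp add: z_def wS)
      then have "f (w n) \<le> r * f z" using up[OF z] by simp
      then have "f (w n) / r \<le> f z" using r by (simp add: divide_le_eq mult.commute)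
      moreover have "3 * f (w (Suc n)) = (r * f (w (Suc n)) - g (w (Suc n))) + f (w (Suc (Suc n))) + f z"
        using harm[OF w[of "Suc n"]] by (simp add: g_def z_def wS)
      ultimately show ?thesis by (simp add: algebra_simps)
    qed
    define \<rho> where "\<rho> n = f (w (Suc n)) / f (w n)" for n
    have fpos: "f (w n) > 0" for n using pos w by blast
    have \<rho>pos: "\<rho> n > 0" for n by (simp add: \<rho>_def fpos)
    have step: "\<rho> (Suc n) \<le> \<rho> n - \<kappa> / 2" if n: "n < N" for n
    proof -
      have "g (w (Suc n)) \<le> 3 ^ Suc n * (\<epsilon> * f p)" by (rule gw)
      also have "\<dots> \<le> 3 ^ Suc n * (\<epsilon> * (9 ^ Suc n * f (w (Suc n))))"
        using fw[of "Suc n"] \<epsilon> by (intro mult_left_mono) auto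
      also have "\<dots> = (27 ^ Suc n * \<epsilon>) * f (w (Suc n))"
        by (simp add: power_mult_distrib[symmetric] mult_ac flip: power_Suc)
      also have "\<dots> \<le> (\<kappa> / 2) * f (w (Suc n))"
      proof (intro mult_right_mono)
        have "(27::real) ^ Suc n * \<epsilon> \<le> 27 ^ N * \<epsilon>"
          using n \<epsilon> by (intro mult_right_mono power_increasing) auto
        then show "27 ^ Suc n * \<epsilon> \<le> \<kappa> / 2" by (simp add: \<epsilon>_def)
      qed (use fpos less_imp_le in blast)
      finally have "f (w (Suc (Suc n))) \<le> (3 - r + \<kappa> / 2) * f (w (Suc n)) - f (w n) / r"
        using rec[of n] by (simp add: algebra_simps)
      then have "\<rho> (Suc n) \<le> ((3 - r + \<kappa> / 2) * f (w (Suc n)) - f (w n) / r) / f (w (Suc n))"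
        using fpos[of "Suc n"] unfolding \<rho>_def by (intro divide_right_mono) auto
      also have "\<dots> = 3 - r + \<kappa> / 2 - 1 / (r * \<rho> n)"
        using fpos[of "Suc n"] fpos[of n] r by (simp add: \<rho>_def field_simps)
      finally have le: "\<rho> (Suc n) \<le> 3 - r + \<kappa> / 2 - 1 / (r * \<rho> n)" .
      \<comment> \<open>Inequality of arithmetic and geometric means for \<open>\<rho> n\<close> and
        \<open>1 / (r * \<rho> n)\<close>.\<close>
      have "1 / (r * \<rho> n) \<ge> 2 / sqrt r - \<rho> n"
      proof -
        define t where "t = sqrt r"
        have t: "t > 0" "r = t * t" using r by (auto simp: t_def)
        have "(t * \<rho> n - 1)^2 \<ge> 0" by simp
        then have "2 * t * \<rho> n - t * t * \<rho> n * \<rho> n \<le> 1"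
          by (simp add: power2_eq_square algebra_simps)
        then have "(2 * t * \<rho> n - t * t * \<rho> n * \<rho> n) / (r * \<rho> n) \<le> 1 / (r * \<rho> n)"
          using r \<rho>pos[of n] by (intro divide_right_mono) auto
        also have "(2 * t * \<rho> n - t * t * \<rho> n * \<rho> n) / (r * \<rho> n) = 2 / t - \<rho> n"
          using t \<rho>pos[of n] by (simp add: field_simps)
        finally show ?thesis by (simp add: t_def)
      qed
      with le show ?thesis by (simp add: \<kappa>_def field_simps)
    qed
    have "\<rho> n \<le> \<rho> 0 - real n * (\<kappa> / 2)" if "n \<le> N" for n
      using that
    proof (induction n)
      case (Suc n)
      then show ?case using step[of n] by (simp add: algebra_simps add_divide_distrib)
    qed simp
    from this[of N] have "\<rho> 0 > real N * (\<kappa> / 2)" using \<rho>pos[of N] by simp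
    moreover have "\<rho> 0 \<le> 3" using le3(2)[OF w[of 0]] fpos[of 0] by (simp add: \<rho>_def wS divide_le_eq)
    ultimately show False using N \<kappa> by (simp add: field_simps)
  qed
  then have "r * f q \<le> 1 * f q" using pos[OF q] by (intro mult_right_mono) auto
  then show ?thesis using up[OF q] by simp
qed

section \<open>Combinatorics of the corners\<close>

text \<open>The shift rules for \<open>D\<close>, \<open>C\<close> and \<open>S\<close> match
  indices of the form \<open>k + n\<close>; these rewrites restore it when the numeral stands in
  front.\<close>

lemma int_num_commute:
  fixes k :: int
  shows "2 + k = k + 2" "3 + k = k + 3" "4 + k = k + 4" "5 + k = k + 5"
    "6 + k = k + 6" "7 + k = k + 7" "8 + k = k + 8" "9 + k = k + 9" "10 + k = k + 10"
    "11 + k = k + 11" "12 + k = k + 12"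
  by simp_all

text \<open>\<open>C p k s\<close> says that a tile of size \<open>s\<close> has a corner at \<open>p\<close> spanned by the directions
  \<open>D k\<close> and \<open>D (k + 1)\<close>, the directions being numbered counterclockwise in steps of 60 degrees;
  a tile thus has three descriptions. \<open>side_at D C p m t s\<close> says that \<open>p\<close> is an inner point, at
  distance \<open>t\<close> from the start, of a side in direction \<open>D m\<close> of a tile of size \<open>s\<close> to the left of it;
  this tile covers the sectors \<open>m\<close>, \<open>m + 1\<close>, \<open>m + 2\<close> at \<open>p\<close>.\<close>

definition side_at ::
  "(int \<Rightarrow> 'a::real_vector) \<Rightarrow> ('a \<Rightarrow> int \<Rightarrow> real \<Rightarrow> bool) \<Rightarrow> 'a \<Rightarrow> int \<Rightarrow> real \<Rightarrow> real \<Rightarrow> bool"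
  where "side_at D C p m t s \<longleftrightarrow> 0 < t \<and> t < s \<and> C (p - t *\<^sub>R D m) m s"

locale hex_directions =
  fixes D :: "int \<Rightarrow> 'a::real_vector"
  assumes D_add_2: "D (k + 2) = D (k + 1) - D k"
begin

lemma D_add: "D (k + 3) = - D k" "D (k + 4) = - D (k + 1)" "D (k + 5) = D k - D (k + 1)"
  "D (k + 6) = D k" "D (k + 7) = D (k + 1)" "D (k + 8) = D (k + 1) - D k" "D (k + 9) = - D k"
  "D (k + 10) = - D (k + 1)" "D (k + 11) = D k - D (k + 1)" "D (k + 12) = D k"
proof -
  have *: "D (k + 3) = - D k" for k using D_add_2[of "k + 1"] D_add_2[of k] by (simp add: int_num_commute)
  show "D (k + 3) = - D k" by (rule *)
  show "D (k + 4) = - D (k + 1)" "D (k + 5) = D k - D (k + 1)"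
    using *[of "k + 1"] *[of "k + 2"] D_add_2[of k] by (simp_all add: int_num_commute)
  have **: "D (k + 6) = D k" for k using *[of "k + 3"] *[of k] by (simp add: int_num_commute)
  show "D (k + 6) = D k" by (rule **)
  show "D (k + 7) = D (k + 1)" "D (k + 8) = D (k + 1) - D k" "D (k + 9) = - D k"
    "D (k + 10) = - D (k + 1)" "D (k + 11) = D k - D (k + 1)" "D (k + 12) = D k"
    using **[of k] **[of "k + 1"] **[of "k + 2"] **[of "k + 3"] **[of "k + 4"] **[of "k + 5"] **[of "k + 6"] *
      *[of "k + 1"] *[of "k + 2"] D_add_2[of k] by (simp_all add: int_num_commute)
qed

lemmas D_simps = D_add_2 D_add

lemma D_mod: "k mod 6 = k' mod 6 \<Longrightarrow> D k = D k'"
proof -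
  have "D (k + 6 * n) = D k" for n
  proof (induction n rule: int_induct[where k = 0])
    case (step1 i)
    then show ?case using D_add(4)[of "k + 6 * i"] by (simp add: algebra_simps)
  next
    case (step2 i)
    then show ?case using D_add(4)[of "k + 6 * (i - 1)"] by (simp add: algebra_simps)
  qed simp
  from this[of "(k' - k) div 6"] show "k mod 6 = k' mod 6 \<Longrightarrow> D k = D k'"
    by (simp add: mod_eq_dvd_iff dvd_diff_commute)
qed

end

text \<open>The axioms describe which tile occupies each sector at a vertex. In \<open>cover\<close>
  the three side alternatives are the directions whose side fills sector \<open>k + 2\<close>. In
  \<open>no_share\<close> the two corners have the ray \<open>D (k + 1)\<close> in common, along
  which equal sizes would give a common side.\<close>

locale hex_tiling =
hex_directions D for D :: "int \<Rightarrow> 'a::real_vector" +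
  fixes C :: "'a \<Rightarrow> int \<Rightarrow> real \<Rightarrow> bool" and \<delta> :: real
  assumes \<delta>_pos: "\<delta> > 0"
    and size_ge: "C p k s \<Longrightarrow> \<delta> \<le> s"
    and C_add_6: "C p (k + 6) s \<longleftrightarrow> C p k s"
    and rotate: "C p k s \<Longrightarrow> C (p + s *\<^sub>R D k) (k + 2) s"
    and no_share: "C p k s \<Longrightarrow> C p (k + 1) s' \<Longrightarrow> s \<noteq> s'"
    and cover: "C p j s \<Longrightarrow> (\<exists>s. C p (k + 2) s) \<or> (\<exists>t s. side_at D C p (k + 2) t s) \<or>
      (\<exists>t s. side_at D C p (k + 1) t s) \<or> (\<exists>t s. side_at D C p k t s)"
    and size_unique: "C p k s \<Longrightarrow> C p k s' \<Longrightarrow> s = s'"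
    and corner_not_side: "side_at D C p m t s \<Longrightarrow> i \<in> {0, 1, 2} \<Longrightarrow> \<not> C p (m + i) s'"
    and side_unique: "side_at D C p m t s \<Longrightarrow> side_at D C p m t' s' \<Longrightarrow> t = t' \<and> s = s'"
    and side_not_side: "side_at D C p m t s \<Longrightarrow> i \<in> {1, 2} \<Longrightarrow> \<not> side_at D C p (m + i) t' s'"
begin

abbreviation S where "S \<equiv> side_at D C"

section \<open>Indices modulo six, rotation of tiles and reversal of the numbering\<close>

lemma C_add: "C p (k + 7) s \<longleftrightarrow> C p (k + 1) s" "C p (k + 8) s \<longleftrightarrow> C p (k + 2) s"
  "C p (k + 9) s \<longleftrightarrow> C p (k + 3) s" "C p (k + 10) s \<longleftrightarrow> C p (k + 4) s"
  "C p (k + 11) s \<longleftrightarrow> C p (k + 5) s" "C p (k + 12) s \<longleftrightarrow> C p k s"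
  using C_add_6[of p "k + 1"] C_add_6[of p "k + 2"] C_add_6[of p "k + 3"] C_add_6[of p "k + 4"]
    C_add_6[of p "k + 5"] C_add_6[of p "k + 6"] C_add_6[of p k]
  by (simp_all add: int_num_commute)

lemmas C_simps = C_add_6 C_add

lemma S_add_6: "S p (m + 6) t s \<longleftrightarrow> S p m t s"
  by (simp add: side_at_def C_simps D_simps)

lemma S_add: "S p (k + 7) t s \<longleftrightarrow> S p (k + 1) t s" "S p (k + 8) t s \<longleftrightarrow> S p (k + 2) t s"
  "S p (k + 9) t s \<longleftrightarrow> S p (k + 3) t s" "S p (k + 10) t s \<longleftrightarrow> S p (k + 4) t s"
  "S p (k + 11) t s \<longleftrightarrow> S p (k + 5) t s" "S p (k + 12) t s \<longleftrightarrow> S p k t s"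
  using S_add_6[of p "k + 1"] S_add_6[of p "k + 2"] S_add_6[of p "k + 3"] S_add_6[of p "k + 4"]
    S_add_6[of p "k + 5"] S_add_6[of p "k + 6"]
  by (simp_all add: S_add_6 int_num_commute)

lemmas S_simps = S_add_6 S_add
lemmas hex_simps = C_simps D_simps S_simps int_num_commute

lemma size_pos: "C p k s \<Longrightarrow> s > 0"
  using size_ge \<delta>_pos by force

lemma C_add_mult_6: "C p (k + 6 * n) s \<longleftrightarrow> C p k s"
proof (induction n rule: int_induct[where k = 0])
  case (step1 i)
  then show ?case using C_add_6[of p "k + 6 * i" s] by (simp add: algebra_simps)
next
  case (step2 i)
  then show ?case using C_add_6[of p "k + 6 * (i - 1)" s] by (simp add: algebra_simps)
qed simp

lemma C_mod: "k mod 6 = k' mod 6 \<Longrightarrow> C p k s \<longleftrightarrow> C p k' s"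
  using C_add_mult_6[of p k' "(k - k') div 6" s] by (simp add: mod_eq_dvd_iff)

lemma S_mod: "m mod 6 = m' mod 6 \<Longrightarrow> S p m t s \<longleftrightarrow> S p m' t s"
  using D_mod[of m m'] C_mod[of m m'] by (simp add: side_at_def)

lemma sector_cases:
  assumes "C p j s"
  obtains i where "i \<in> {0..5}" "C p (m + i) s"
  using assms C_mod[of j "m + (j - m) mod 6" p s] that[of "(j - m) mod 6"]
  by (simp add: mod_add_right_eq)

lemma rotate2: "C p k s \<Longrightarrow> C (p + s *\<^sub>R D (k + 1)) (k + 4) s"
  using rotate[OF rotate[of p k s]] by (simp add: hex_simps algebra_simps)

lemma rotate2_iff: "C p k s \<longleftrightarrow> C (p + s *\<^sub>R D (k + 1)) (k + 4) s"
  using rotate2[of p k s] rotate[of "p + s *\<^sub>R D (k + 1)" "k + 4" s]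
  by (auto simp: hex_simps algebra_simps)

text \<open>Reversing the numbering exchanges left and right of a direction. The tile is on the left
  again if its side is read from the other end, which explains \<open>3 - m\<close> and
  \<open>s - t\<close>.\<close>

lemma side_mirror:
  "side_at (\<lambda>k. D (- k)) (\<lambda>p k. C p (- 1 - k)) p m t s \<longleftrightarrow> S p (3 - m) (s - t) s"
proof -
  have "D (3 - m) = - D (- m)" using D_add(1)[of "- m"] by (simp add: algebra_simps)
  then show ?thesis
    using rotate2_iff[of "p - t *\<^sub>R D (- m)" "- 1 - m" s]
    by (auto simp: side_at_def algebra_simps)
qed

text \<open>No point moves: the same directions are numbered clockwise, and the sector between
  \<open>D (- k)\<close> and \<open>D (- k - 1)\<close> had the old number \<open>- 1 - k\<close>.
  Statements about one hand thereby give those about the other.\<close>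

lemma mirror: "hex_tiling (\<lambda>k. D (- k)) (\<lambda>p k. C p (- 1 - k)) \<delta>"
proof
  fix k show "D (- (k + 2)) = D (- (k + 1)) - D (- k)"
    using D_add_2[of "- k - 2"] by (simp add: algebra_simps)
next
  fix p k s assume "C p (- 1 - k) s" then show "\<delta> \<le> s" by (rule size_ge)
next
  fix p k s show "C p (- 1 - (k + 6)) s \<longleftrightarrow> C p (- 1 - k) s"
    by (rule C_mod) (simp add: mod_eq_dvd_iff)
next
  fix p k s assume "C p (- 1 - k) s"
  then have "C (p + s *\<^sub>R D (- k)) (- 1 - k + 4) s"
    using rotate2[of p "- 1 - k" s] by simp
  then show "C (p + s *\<^sub>R D (- k)) (- 1 - (k + 2)) s"
    by (rule C_mod[THEN iffD1, rotated]) (simp add: mod_eq_dvd_iff)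
next
  fix p k s s' assume "C p (- 1 - k) s" "C p (- 1 - (k + 1)) s'"
  moreover have "- 1 - (k + 1) = - 2 - k" "- 1 - k = - 2 - k + 1" by simp_all
  ultimately show "s \<noteq> s'" using no_share[of p "- 2 - k" s' s] by metis
next
  fix p j s k assume "C p (- 1 - j) s"
  from cover[OF this, of "- 5 - k"]
  have 1: "(\<exists>s. C p (- 3 - k) s) \<or> (\<exists>t s. S p (- 3 - k) t s) \<or> (\<exists>t s. S p (- 4 - k) t s) \<or>
    (\<exists>t s. S p (- 5 - k) t s)" by (simp add: algebra_simps)
  have flip: "\<exists>t s. S p m' (s - t) s" if S: "S p m t s" and m: "m mod 6 = m' mod 6" for m m' t s
  proof -
    have "S p m' (s - (s - t)) s" using S S_mod[OF m] by simp
    then show ?thesis by blast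
  qed
  have "(- 3 - k) mod 6 = (3 - k) mod 6" "(- 4 - k) mod 6 = (2 - k) mod 6"
    "(- 5 - k) mod 6 = (1 - k) mod 6" by (simp_all add: mod_eq_dvd_iff)
  note flips = flip[OF _ this(1)] flip[OF _ this(2)] flip[OF _ this(3)]
  have e: "- 1 - (k + 2) = - 3 - k" "3 - (k + 1) = 2 - k" "3 - (k + 2) = 1 - k" by simp_all
  have 2: "(\<exists>s. C p (- 3 - k) s) \<or> (\<exists>t s. S p (1 - k) (s - t) s) \<or>
    (\<exists>t s. S p (2 - k) (s - t) s) \<or> (\<exists>t s. S p (3 - k) (s - t) s)"
    using 1
  proof (elim disjE exE)
    fix t s assume "S p (- 3 - k) t s"
    from flips(1)[OF this] show ?thesis by blast
  next
    fix t s assume "S p (- 4 - k) t s"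
    from flips(2)[OF this] show ?thesis by blast
  next
    fix t s assume "S p (- 5 - k) t s"
    from flips(3)[OF this] show ?thesis by blast
  qed blast
  show "(\<exists>s. C p (- 1 - (k + 2)) s) \<or>
    (\<exists>t s. side_at (\<lambda>k. D (- k)) (\<lambda>p k. C p (- 1 - k)) p (k + 2) t s) \<or>
    (\<exists>t s. side_at (\<lambda>k. D (- k)) (\<lambda>p k. C p (- 1 - k)) p (k + 1) t s) \<or>
    (\<exists>t s. side_at (\<lambda>k. D (- k)) (\<lambda>p k. C p (- 1 - k)) p k t s)"
    unfolding side_mirror e by (rule 2)
next
  fix p k s s' assume "C p (- 1 - k) s" "C p (- 1 - k) s'"
  then show "s = s'" by (rule size_unique)
next
  fix p m t s s' i assume "side_at (\<lambda>k. D (- k)) (\<lambda>p k. C p (- 1 - k)) p m t s"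
    and i: "i \<in> {0, 1, 2::int}"
  then have s: "S p (3 - m) (s - t) s" by (simp add: side_mirror)
  have "\<not> C p (3 - m + (2 - i)) s'" by (rule corner_not_side[OF s]) (use i in auto)
  then show "\<not> C p (- 1 - (m + i)) s'"
    using C_add_6[of p "- 1 - (m + i)" s'] by (simp add: algebra_simps)
next
  fix p m t s t' s' assume "side_at (\<lambda>k. D (- k)) (\<lambda>p k. C p (- 1 - k)) p m t s"
    "side_at (\<lambda>k. D (- k)) (\<lambda>p k. C p (- 1 - k)) p m t' s'"
  then show "t = t' \<and> s = s'" unfolding side_mirror by (auto dest: side_unique)
next
  fix p m t s t' s' i assume "side_at (\<lambda>k. D (- k)) (\<lambda>p k. C p (- 1 - k)) p m t s"
    and i: "i \<in> {1, 2::int}"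
  then have s: "S p (3 - m) (s - t) s" by (simp add: side_mirror)
  show "\<not> side_at (\<lambda>k. D (- k)) (\<lambda>p k. C p (- 1 - k)) p (m + i) t' s'"
    unfolding side_mirror
  proof
    assume "S p (3 - (m + i)) (s' - t') s'"
    from side_not_side[OF this i] show False using s by simp
  qed
qed (rule \<delta>_pos)

text \<open>The corner \<open>c\<close> rules out that two sides pass each other at
  \<open>p\<close>: a side in direction \<open>m + 3\<close> would fill the other three sectors and
  leave no room for it. A side in any remaining direction would overlap the given one.\<close>

lemma corners_at_side:
  assumes s: "S p m t s" and c: "C p j s'"
  obtains x n y where "C p (m + 3) x" "C p (m + 4) n" "C p (m + 5) y"
proof -
  have no: "\<not> S p (m + 1) t' s''" "\<not> S p (m + 2) t' s''" "\<not> S p (m + 4) t' s''" "\<not> S p (m + 5) t' s''"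
    for t' s''
    using side_not_side[OF s] side_not_side[of p "m + 4" t' s'' 2 t s]
      side_not_side[of p "m + 5" t' s'' 1 t s] s by (auto simp: hex_simps)
  obtain i where i: "i \<in> {0..5}" "C p (m + i) s'" using sector_cases[OF c] by blast
  have "i \<in> {0, 1, 2} \<or> i \<in> {3, 4, 5}" using i(1) by auto
  then have no3: "\<not> S p (m + 3) t' s''" for t' s''
  proof
    assume "i \<in> {0, 1, 2}" then show ?thesis using corner_not_side[OF s] i by blast
  next
    assume *: "i \<in> {3, 4, 5}"
    show ?thesis
    proof
      assume "S p (m + 3) t' s''"
      from corner_not_side[OF this, of "i - 3"] show False using i(2) * by auto
    qed
  qed
  have "\<exists>x. C p (m + 3) x" "\<exists>x. C p (m + 4) x" "\<exists>x. C p (m + 5) x"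
    using cover[OF c, of "m + 1"] cover[OF c, of "m + 2"] cover[OF c, of "m + 3"] no no3
    by (auto simp: hex_simps)
  then show thesis using that by blast
qed

text \<open>Both tiles lie to the left of the segment of length \<open>b\<close> from
  \<open>p\<close>, one at each end. If their sides overlapped, an inner point common to both would
  make them one tile with side \<open>b\<close>, contrary to \<open>c \<noteq> b\<close>. The primed
  variant concerns the right of the segment.\<close>

lemma opposite_sides_disjoint:
  assumes c: "C p k c" and g: "C (p + b *\<^sub>R D k) (k + 2) g" and "c \<noteq> b" "b > 0"
  shows "c + g \<le> b"
proof (rule ccontr)
  assume "\<not> c + g \<le> b"
  moreover have "c > 0" "g > 0" using c g size_pos by auto
  ultimately obtain \<tau> where \<tau>: "max 0 (b - g) < \<tau>" "\<tau> < min b c"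
    using dense[of "max 0 (b - g)" "min b c"] \<open>b > 0\<close> by auto
  define z where "z = p + \<tau> *\<^sub>R D k"
  have "S z k \<tau> c" using \<tau> c by (simp add: side_at_def z_def)
  moreover have "S z k (\<tau> - b + g) g"
    using \<tau> rotate2[OF g] by (simp add: side_at_def z_def hex_simps algebra_simps)
  ultimately have "\<tau> = \<tau> - b + g" "c = g" using side_unique by blast+
  then show False using \<open>c \<noteq> b\<close> by simp
qed

lemma opposite_sides_disjoint':
  assumes c: "C p (k + 5) c" and g: "C (p + b *\<^sub>R D k) (k + 3) g" and "c \<noteq> b" "b > 0"
  shows "c + g \<le> b"
proof (rule ccontr)
  assume "\<not> c + g \<le> b"
  moreover have "c > 0" "g > 0" using c g size_pos by auto
  ultimately obtain \<tau> where \<tau>: "max 0 (b - g) < \<tau>" "\<tau> < min b c"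
    using dense[of "max 0 (b - g)" "min b c"] \<open>b > 0\<close> by auto
  define z where "z = p + \<tau> *\<^sub>R D k"
  have "S z (k + 3) (c - \<tau>) c" using \<tau> rotate2[OF c]
    by (simp add: side_at_def z_def hex_simps algebra_simps)
  moreover have "S z (k + 3) (b - \<tau>) g"
    using \<tau> g by (simp add: side_at_def z_def hex_simps algebra_simps)
  ultimately have "c - \<tau> = b - \<tau>" using side_unique by blast
  then show False using \<open>c \<noteq> b\<close> by simp
qed

text \<open>The middle corner of three consecutive ones is smaller than its counterclockwise
  (\<open>bad_left\<close>) or clockwise (\<open>bad_right\<close>) neighbour.\<close>

definition bad_left where
  "bad_left b \<longleftrightarrow> (\<exists>p k a c. C p (k + 5) c \<and> C p k b \<and> C p (k + 1) a \<and> b < a)"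
definition bad_right where
  "bad_right b \<longleftrightarrow> (\<exists>p k a c. C p (k + 5) a \<and> C p k b \<and> C p (k + 1) c \<and> b < a)"

text \<open>The larger neighbour \<open>a\<close> runs past the corner \<open>w\<close>, so the tile
  \<open>d\<close> beyond \<open>w\<close> is the middle of three corners there, one of which is
  \<open>b\<close> itself. If \<open>d\<close> is not smaller by \<open>\<delta>\<close>, the tile
  \<open>g\<close> at the third corner \<open>x\<close> takes its place. The new bad corner has its
  larger neighbour on the other hand, hence the two predicates.\<close>

lemma bad_left_descends:
  assumes "bad_left b"
  obtains b' where "b' \<le> b - \<delta>" "bad_right b'"
proof -
  note * = that
  obtain p k a c where c: "C p (k + 5) c" and b: "C p k b" and a: "C p (k + 1) a" and ba: "b < a"
    using assms by (auto simp: bad_left_def)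
  have bpos: "b > 0" using size_pos[OF b] .
  define w where "w = p + b *\<^sub>R D (k + 1)"
  define x where "x = p + b *\<^sub>R D k"
  have xw: "x = w + b *\<^sub>R D (k + 5)" by (simp add: x_def w_def hex_simps algebra_simps)
  have bw: "C w (k + 4) b" using rotate2[OF b] by (simp add: w_def)
  have bx: "C x (k + 2) b" using rotate[OF b] by (simp add: x_def)
  have "S w (k + 1) b a" using a ba bpos by (simp add: side_at_def w_def)
  from corners_at_side[OF this bw] obtain d f where d: "C w (k + 5) d" and f: "C w k f"
    by (simp add: hex_simps) blast
  have db: "d \<noteq> b" using no_share[OF bw] d by (auto simp: hex_simps)
  have cb: "c \<noteq> b" using no_share[OF c] b by (auto simp: hex_simps)
  have bad_d: "bad_right d" if "d < b"
    unfolding bad_right_def using that bw d f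
    by (intro exI[of _ w] exI[of _ "k + 5"] exI[of _ b] exI[of _ f]) (simp add: hex_simps)
  \<comment> \<open>A side running past \<open>x\<close> forces a corner \<open>g\<close> next to
    the tile, and \<open>g\<close> has to share the side from \<open>p\<close> to \<open>x\<close>
    with \<open>c\<close>.\<close>
  have bad_g: thesis if "S x (k + 5) t s" "c < b" for t s
  proof -
    from corners_at_side[OF that(1) bx] obtain g h where g: "C x (k + 3) g" and h: "C x (k + 4) h"
      by (simp add: hex_simps) blast
    have cg: "c + g \<le> b" using opposite_sides_disjoint'[OF c, of b g] g cb bpos by (simp add: x_def)
    have "bad_right g" unfolding bad_right_def using g h bx cg size_pos[OF c]
      by (intro exI[of _ x] exI[of _ "k + 3"] exI[of _ b] exI[of _ h]) (simp add: hex_simps)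
    then show thesis using *[of g] cg size_ge[OF c] by simp
  qed
  have Sx: "S x (k + 5) b d" if "b < d" using that d bpos by (simp add: side_at_def xw)
  show thesis
  proof (cases "c < b")
    case True
    show thesis
    proof (cases "b < d")
      case True
      then show thesis using bad_g[OF Sx] \<open>c < b\<close> by blast
    next
      case False
      then have "d < b" using db by simp
      show thesis
      proof (cases "d \<le> b - \<delta>")
        case True
        then show thesis using that bad_d \<open>d < b\<close> by blast
      next
        case False
        \<comment> \<open>The stretch of length \<open>b - d\<close> left over on the side is
          shorter than any tile, so the tile \<open>e\<close> following \<open>d\<close> runs past
          \<open>x\<close>.\<close>
        define x' where "x' = w + d *\<^sub>R D (k + 5)"
        have xx': "x = x' + (b - d) *\<^sub>R D (k + 5)" by (simp add: x'_def xw algebra_simps)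
        have "S x' (k + 2) (b - d) b" using \<open>d < b\<close> bx size_pos[OF d]
          by (simp add: side_at_def xx' hex_simps algebra_simps)
        moreover have "C x' (k + 1) d" using rotate[OF d] by (simp add: x'_def hex_simps)
        ultimately obtain e where e: "C x' (k + 5) e"
          using corners_at_side[of x' "k + 2"] by (simp add: hex_simps) blast
        then have "S x (k + 5) (b - d) e" using False size_ge[OF e] \<open>d < b\<close>
          by (simp add: side_at_def xx')
        then show thesis using bad_g \<open>c < b\<close> by blast
      qed
    qed
  next
    case False
    then have bc: "b < c" using cb by simp
    \<comment> \<open>Now \<open>c\<close> runs past \<open>x\<close>. The side of \<open>d\<close>
      cannot do so too, hence \<open>d\<close> shares the side from \<open>w\<close> to
      \<open>x\<close> with a further tile \<open>d'\<close>.\<close>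
    have sx: "S x (k + 3) (c - b) c" using rotate2[OF c] bc bpos
      by (simp add: side_at_def x_def hex_simps algebra_simps)
    then have "\<not> S x (k + 5) b d" using side_not_side[OF sx, of 2] by (simp add: hex_simps)
    then have "d < b" using Sx db by fastforce
    from corners_at_side[OF sx bx] obtain d' where d': "C x (k + 1) d'"
      by (simp add: hex_simps) blast
    have "d + d' \<le> b" using opposite_sides_disjoint[OF d, of b d'] d' db bpos
      by (simp add: hex_simps xw)
    then show thesis using that[of d] bad_d \<open>d < b\<close> size_ge[OF d'] by simp
  qed
qed

lemma bad_mirror:
  "hex_tiling.bad_left (\<lambda>p k. C p (- 1 - k)) b \<longleftrightarrow> bad_right b"
  "hex_tiling.bad_right (\<lambda>p k. C p (- 1 - k)) b \<longleftrightarrow> bad_left b"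
proof -
  have C_cong: "C p i s \<Longrightarrow> i mod 6 = j mod 6 \<Longrightarrow> C p j s" for p i j s
    using C_mod by blast
  show "hex_tiling.bad_left (\<lambda>p k. C p (- 1 - k)) b \<longleftrightarrow> bad_right b"
    unfolding hex_tiling.bad_left_def[OF mirror] bad_right_def
  proof (intro iffI; elim exE conjE)
    fix p k a c
    assume "C p (- 1 - (k + 5)) c" "C p (- 1 - k) b" "C p (- 1 - (k + 1)) a" "b < a"
    then show "\<exists>p k a c. C p (k + 5) a \<and> C p k b \<and> C p (k + 1) c \<and> b < a"
      by (intro exI[of _ p] exI[of _ "- 1 - k"] exI[of _ a] exI[of _ c] conjI)
        (assumption | erule C_cong, simp add: mod_eq_dvd_iff)+
  next
    fix p k a c
    assume "C p (k + 5) a" "C p k b" "C p (k + 1) c" "b < a"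
    then show "\<exists>p k a c. C p (- 1 - (k + 5)) c \<and> C p (- 1 - k) b \<and> C p (- 1 - (k + 1)) a \<and> b < a"
      by (intro exI[of _ p] exI[of _ "- 1 - k"] exI[of _ a] exI[of _ c] conjI)
        (assumption | erule C_cong, simp add: mod_eq_dvd_iff)+
  qed
  show "hex_tiling.bad_right (\<lambda>p k. C p (- 1 - k)) b \<longleftrightarrow> bad_left b"
    unfolding hex_tiling.bad_right_def[OF mirror] bad_left_def
  proof (intro iffI; elim exE conjE)
    fix p k a c
    assume "C p (- 1 - (k + 5)) a" "C p (- 1 - k) b" "C p (- 1 - (k + 1)) c" "b < a"
    then show "\<exists>p k a c. C p (k + 5) c \<and> C p k b \<and> C p (k + 1) a \<and> b < a"
      by (intro exI[of _ p] exI[of _ "- 1 - k"] exI[of _ a] exI[of _ c] conjI)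
        (assumption | erule C_cong, simp add: mod_eq_dvd_iff)+
  next
    fix p k a c
    assume "C p (k + 5) c" "C p k b" "C p (k + 1) a" "b < a"
    then show "\<exists>p k a c. C p (- 1 - (k + 5)) a \<and> C p (- 1 - k) b \<and> C p (- 1 - (k + 1)) c \<and> b < a"
      by (intro exI[of _ p] exI[of _ "- 1 - k"] exI[of _ a] exI[of _ c] conjI)
        (assumption | erule C_cong, simp add: mod_eq_dvd_iff)+
  qed
qed

lemma not_bad: "\<not> bad_left b" "\<not> bad_right b"
proof -
  have pos: "b > 0" if "bad_left b \<or> bad_right b" for b
    using that size_pos by (auto simp: bad_left_def bad_right_def)
  \<comment> \<open>Sizes are real numbers, so the descent is counted in multiples of
    \<open>\<delta>\<close>.\<close>
  have "b < real n * \<delta> \<Longrightarrow> \<not> bad_left b \<and> \<not> bad_right b" for n b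
  proof (induction n arbitrary: b)
    case 0 then show ?case using pos[of b] by auto
  next
    case (Suc n)
    show ?case
    proof (intro conjI notI)
      assume "bad_left b"
      from bad_left_descends[OF this] obtain b' where "b' \<le> b - \<delta>" "bad_right b'" by blast
      then show False using Suc by (auto simp: algebra_simps)
    next
      assume "bad_right b"
      from hex_tiling.bad_left_descends[OF mirror, unfolded bad_mirror, OF this]
      obtain b' where "b' \<le> b - \<delta>" "bad_left b'" by blast
      then show False using Suc by (auto simp: algebra_simps)
    qed
  qed
  moreover obtain n where "b / \<delta> < real n" using reals_Archimedean2 by blast
  ultimately show "\<not> bad_left b" "\<not> bad_right b" using \<delta>_pos by (auto simp: field_simps)
qed

section \<open>Vertices on sides, large and small tiles\<close>

lemma middle_largest:
  assumes "C p k x" "C p (k + 1) n" "C p (k + 2) y"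
  shows "x < n" "y < n"
proof -
  have "C p (k + 1 + 5) x" using assms(1) by (simp add: hex_simps)
  then have "\<not> n < x" "\<not> n < y"
    using not_bad[of n] assms unfolding bad_left_def bad_right_def
    by (auto simp: algebra_simps dest!: spec[of _ p] spec[of _ "k + 1"])
  moreover have "x \<noteq> n" using no_share assms by blast
  moreover have "y \<noteq> n" using no_share[OF assms(2), of y] assms(3) by (auto simp: algebra_simps)
  ultimately show "x < n" "y < n" by auto
qed

text \<open>With six corners, each of two adjacent ones would be the middle of three and hence
  larger than the other.\<close>

lemma vertex_on_side:
  assumes c: "C p k s"
  obtains m t l where "S p m t l"
proof (rule ccontr)
  assume "\<not> thesis"
  then have no: "\<not> S p m t l" for m t l using that by blast
  have all: "\<exists>s. C p (j + 2) s" for j using cover[OF c, of j] no by blast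
  from all[of "k - 2"] all[of "k - 1"] all[of k] all[of "k + 1"]
  obtain x0 x1 x2 x3 where "C p k x0" "C p (k + 1) x1" "C p (k + 2) x2" "C p (k + 3) x3"
    by (auto simp: hex_simps add.commute[of 1 k])
  then show False using middle_largest(2)[of p k x0 x1 x2] middle_largest(1)[of p "k + 1" x1 x2 x3]
    by (simp add: hex_simps)
qed

text \<open>Stepping three times leads around the small tile at \<open>C p (m + 3) x\<close> and back to \<open>p\<close>.\<close>

lemma side_step:
  assumes s: "S p m t s" and x: "C p (m + 3) x"
  obtains n where "C p (m + 4) n" "x < n" "S (p + x *\<^sub>R D (m + 4)) (m + 4) x n"
    "C (p + x *\<^sub>R D (m + 4)) (m + 4 + 3) x"
proof -
  obtain n y where n: "C p (m + 4) n" and y: "C p (m + 5) y" using corners_at_side[OF s x] by blast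
  have "x < n" using middle_largest(1)[of p "m + 3" x n y] x n y by (simp add: hex_simps)
  moreover have "S (p + x *\<^sub>R D (m + 4)) (m + 4) x n"
    using n \<open>x < n\<close> size_pos[OF x] by (simp add: side_at_def)
  ultimately show thesis using that n rotate2[OF x] by (simp add: hex_simps)
qed

text \<open>Back at \<open>p\<close> after three steps, the side found there has its start at
  distance \<open>x\<close>, and uniqueness identifies it with the given side. So the small tile
  reaches exactly to the start of the side, and no further.\<close>

lemma side_start:
  assumes s: "S p m t s" and x: "C p (m + 3) x"
  shows "t = x" "\<exists>t' s'. S (p - x *\<^sub>R D m) (m + 2) t' s'"
proof -
  obtain n where 1: "S (p + x *\<^sub>R D (m + 4)) (m + 4) x n" "C (p + x *\<^sub>R D (m + 4)) (m + 4 + 3) x"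
    using side_step[OF s x] by blast
  define q where "q = p + x *\<^sub>R D (m + 4) + x *\<^sub>R D (m + 4 + 4)"
  obtain n' where 2: "S q (m + 4 + 4) x n'" "C q (m + 4 + 4 + 3) x"
    using side_step[OF 1] unfolding q_def by blast
  have q: "q = p - x *\<^sub>R D m" by (simp add: q_def hex_simps algebra_simps)
  obtain n'' where "S (q + x *\<^sub>R D (m + 4 + 4 + 4)) (m + 4 + 4 + 4) x n''"
    using side_step[OF 2] by blast
  then have "S p m x n''" by (simp add: q hex_simps)
  then show "t = x" using side_unique s by blast
  show "\<exists>t' s'. S (p - x *\<^sub>R D m) (m + 2) t' s'" using 2(1) by (auto simp: q hex_simps)
qed

lemma side_end:
  assumes s: "S p m t s" and y: "C p (m + 5) y"
  shows "s - t = y" "\<exists>t' s'. S (p + y *\<^sub>R D m) (m + 4) t' s'"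
proof -
  have s': "side_at (\<lambda>k. D (- k)) (\<lambda>p k. C p (- 1 - k)) p (3 - m) (s - t) s"
    using s by (simp add: side_mirror)
  have y': "C p (- 1 - (3 - m + 3)) y"
    using y by (rule C_mod[THEN iffD1, rotated]) (simp add: mod_eq_dvd_iff)
  have D: "D (- (3 - m)) = - D m" using D_add(1)[of "m - 3"] by simp
  note * = hex_tiling.side_start[OF mirror s' y']
  show "s - t = y" by (rule *)
  have "\<exists>t' s'. S (p + y *\<^sub>R D m) (m - 2) (s' - t') s'"
    using *(2) unfolding side_mirror D by simp
  then show "\<exists>t' s'. S (p + y *\<^sub>R D m) (m + 4) t' s'"
    using S_mod[of "m - 2" "m + 4"] by (simp add: mod_eq_dvd_iff) blast
qed

text \<open>A corner of size \<open>l\<close> in the middle position, with the sizes \<open>x\<close> and \<open>z\<close> of its clockwise and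
  counterclockwise neighbours.\<close>

definition large where
  "large p k l x z \<longleftrightarrow> (\<exists>t s. S p (k + 2) t s) \<and> C p k l \<and> C p (k + 5) x \<and> C p (k + 1) z"

lemma large_add_6: "large p (k + 6) l x z \<longleftrightarrow> large p k l x z"
  by (simp add: large_def hex_simps)

lemma large_unique:
  "large p k l x z \<Longrightarrow> large p k l' x' z' \<Longrightarrow> l = l' \<and> x = x' \<and> z = z'"
  using size_unique by (auto simp: large_def)

lemma large_less: "large p k l x z \<Longrightarrow> 0 < x \<and> x < l \<and> 0 < z \<and> z < l"
  using middle_largest[of p "k + 5" x l z] size_pos by (auto simp: large_def hex_simps)

lemma large_exists:
  assumes "C p k s"
  obtains k l x z where "large p k l x z"
proof -
  obtain m t l where s: "S p m t l" using vertex_on_side[OF assms] .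
  from corners_at_side[OF s assms] obtain x n y
    where "C p (m + 3) x" "C p (m + 4) n" "C p (m + 5) y" .
  then have "large p (m + 4) n x y" using s by (auto simp: large_def hex_simps)
  then show thesis by (rule that)
qed

text \<open>As \<open>x < l\<close>, the first side has a vertex at distance \<open>x\<close>, where
  the two small tiles along this side meet. The last claim prepares the proof that the next corner
  is in the middle position too.\<close>

lemma large_first:
  assumes "large p k l x z"
  shows "S (p + x *\<^sub>R D k) k x l" "C (p + x *\<^sub>R D k) (k + 3) x" "C (p + x *\<^sub>R D k) (k + 5) (l - x)"
    "\<exists>t s. S (p + l *\<^sub>R D k) (k + 4) t s"
proof -
  have l: "C p k l" and x: "C p (k + 5) x" using assms by (auto simp: large_def)
  show s: "S (p + x *\<^sub>R D k) k x l" using large_less[OF assms] l by (simp add: side_at_def)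
  show c: "C (p + x *\<^sub>R D k) (k + 3) x" using rotate2[OF x] by (simp add: hex_simps)
  obtain y where y: "C (p + x *\<^sub>R D k) (k + 5) y" using corners_at_side[OF s c] by blast
  have "l - x = y" using side_end[OF s y] by simp
  then show "C (p + x *\<^sub>R D k) (k + 5) (l - x)" using y by simp
  show "\<exists>t s. S (p + l *\<^sub>R D k) (k + 4) t s"
    using side_end(2)[OF s y] \<open>l - x = y\<close> by (auto simp: algebra_simps)
qed

lemma large_rotate:
  assumes "large p k l x z"
  obtains x' where "large (p + l *\<^sub>R D k) (k + 2) l x' (l - x)"
proof -
  note * = large_first[OF assms]
  have l: "C (p + l *\<^sub>R D k) (k + 2) l" using assms rotate by (auto simp: large_def)
  have y: "C (p + l *\<^sub>R D k) (k + 3) (l - x)"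
    using rotate2[OF *(3)] by (simp add: hex_simps algebra_simps)
  obtain t s where s: "S (p + l *\<^sub>R D k) (k + 4) t s" using *(4) by blast
  obtain x' where "C (p + l *\<^sub>R D k) (k + 4 + 3) x'" using corners_at_side[OF s l] by blast
  then have "large (p + l *\<^sub>R D k) (k + 2) l x' (l - x)"
    using l y s by (auto simp: large_def hex_simps)
  then show thesis by (rule that)
qed

text \<open>At \<open>p\<close> the two small tiles meet on a side of another tile, whose length is
  therefore \<open>x + z\<close>. At the start of that side the tile is in the middle position, with
  the same small tile \<open>x\<close> clockwise of it.\<close>

lemma large_flip:
  assumes "large p k l x z"
  obtains z' where "large (p - x *\<^sub>R D (k + 2)) (k + 2) (x + z) x z'"
proof -
  obtain t s where s: "S p (k + 2) t s" using assms by (auto simp: large_def)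
  have x: "C p (k + 2 + 3) x" and z: "C p (k + 2 + 5) z"
    using assms by (simp_all add: large_def hex_simps)
  define q where "q = p - x *\<^sub>R D (k + 2)"
  have t: "t = x" "s = x + z" using side_start(1)[OF s x] side_end(1)[OF s z] by auto
  have l: "C q (k + 2) (x + z)" using s t by (simp add: side_at_def q_def)
  obtain t' s' where s': "S q (k + 2 + 2) t' s'" using side_start(2)[OF s x] q_def by blast
  obtain z' where z': "C q (k + 2 + 2 + 5) z'" using corners_at_side[OF s' l] by blast
  have "C q (k + 2 + 5) x" using rotate[OF x] by (simp add: q_def hex_simps algebra_simps)
  then have "large q (k + 2) (x + z) x z'" using l s' z' by (auto simp: large_def hex_simps)
  then show thesis using that q_def by blast
qed

end

section \<open>Rigidity of the sizes\<close>

text \<open>\<open>R\<close> and \<open>F\<close> generate an action of the (3,3,3) triangle group; \<open>a\<close>, \<open>b\<close> and \<open>c\<close> are its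
  translations.\<close>

lemma triangle_group_translations:
  assumes Q: "\<And>q. q \<in> Q \<Longrightarrow> R q \<in> Q" "\<And>q. q \<in> Q \<Longrightarrow> F q \<in> Q"
    and R: "\<And>q. q \<in> Q \<Longrightarrow> R (R (R q)) = q"
    and F: "\<And>q. q \<in> Q \<Longrightarrow> F (F (F q)) = q"
    and RF: "\<And>q. q \<in> Q \<Longrightarrow> R (F (R (F (R (F q))))) = q"
    and q: "q \<in> Q"
  defines "a \<equiv> \<lambda>q. R (R (F q))" and "b \<equiv> \<lambda>q. F (R (R q))" and "c \<equiv> \<lambda>q. R (F (R q))"
  shows "a (b q) = b (a q)" "a (c q) = c (a q)" "b (c q) = c (b q)" "a (b (c q)) = q"
proof -
  \<comment> \<open>The relation \<open>(R F)^3 = 1\<close> in three solved forms; the inverses of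
    \<open>R\<close> and \<open>F\<close> are their squares.\<close>
  have 1: "R (F (R (F q))) = F (F (R (R q)))"
    using RF[of "F (F (R (R q)))"] Q q R F by simp
  have 2: "R (F (R (F (R (R q))))) = F (F (R q))"
    using RF[of "F (F (R q))"] Q q R F by simp
  have 3: "R (F (R (F (R q)))) = F (F q)"
    using RF[of "F (F q)"] Q q R F by simp
  show "a (b q) = b (a q)" unfolding a_def b_def using R Q q by (simp flip: 1)
  show "a (c q) = c (a q)" unfolding a_def c_def using R Q q by (simp add: 3)
  show bc: "b (c q) = c (b q)" unfolding b_def c_def using R Q q by (simp add: 2)
  show "a (b (c q)) = q" unfolding bc unfolding a_def b_def c_def using R F Q q by (simp add: 2)
qed

context hex_tiling
begin

lemma large_cong: "k mod 6 = k' mod 6 \<Longrightarrow> large p k l x z \<longleftrightarrow> large p k' l x z"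
proof -
  assume *: "k mod 6 = k' mod 6"
  then have "(k + n) mod 6 = (k' + n) mod 6" for n by (metis mod_add_left_eq)
  then have "C p k s \<longleftrightarrow> C p k' s" "C p (k + 5) s \<longleftrightarrow> C p (k' + 5) s"
    "C p (k + 1) s \<longleftrightarrow> C p (k' + 1) s" "S p (k + 2) t s \<longleftrightarrow> S p (k' + 2) t s" for s t
    using C_mod[OF *] C_mod[of "k + 5" "k' + 5"] C_mod[of "k + 1" "k' + 1"]
      S_mod[of "k + 2" "k' + 2"] by blast+
  then show ?thesis by (simp only: large_def)
qed

lemma D_mod_6: "D (k mod 6) = D k" "D (k mod 6 + n) = D (k + n)" "D (n + k mod 6) = D (k + n)"
  by (rule D_mod; simp add: mod_simps add.commute)+

text \<open>A flag is a corner of a large tile, with direction index normalised to \<open>{0..<6}\<close>. \<open>flag_rot\<close> passes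
  to the next corner of the same large tile, and \<open>flag_flip\<close> to the next large tile around the small
  tile clockwise of the corner.\<close>

definition "flags = {(p, k). 0 \<le> k \<and> k < 6 \<and> (\<exists>l x z. large p k l x z)}"
definition "flag_len q = (THE l. \<exists>x z. large (fst q) (snd q) l x z)"
definition "flag_x q = (THE x. \<exists>l z. large (fst q) (snd q) l x z)"
definition "flag_z q = (THE z. \<exists>l x. large (fst q) (snd q) l x z)"
definition "flag_rot q = (fst q + flag_len q *\<^sub>R D (snd q), (snd q + 2) mod 6)"
definition "flag_flip q = (fst q - flag_x q *\<^sub>R D (snd q + 2), (snd q + 2) mod 6)"

lemma flag_eqs:
  assumes "large p k l x z"
  shows "(p, k mod 6) \<in> flags" "flag_len (p, k mod 6) = l" "flag_x (p, k mod 6) = x"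
    "flag_z (p, k mod 6) = z"
proof -
  have *: "large p (k mod 6) l x z" using assms large_cong[of k "k mod 6"] by simp
  then show "(p, k mod 6) \<in> flags" by (auto simp: flags_def)
  show "flag_len (p, k mod 6) = l" "flag_x (p, k mod 6) = x" "flag_z (p, k mod 6) = z"
    unfolding flag_len_def flag_x_def flag_z_def fst_conv snd_conv
    by (rule the_equality; use * large_unique[OF *] in blast)+
qed

lemma flags_cases:
  assumes "q \<in> flags"
  obtains p k l x z where "q = (p, k mod 6)" "k mod 6 = k" "large p k l x z"
proof -
  from assms obtain p k l x z where "q = (p, k)" "0 \<le> k" "k < 6" "large p k l x z"
    by (auto simp: flags_def)
  then show thesis using that by simp
qed

lemma flag_rot:
  assumes "q \<in> flags"
  shows "flag_rot q \<in> flags" "flag_len (flag_rot q) = flag_len q"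
    "flag_z (flag_rot q) = flag_len q - flag_x q"
proof -
  from assms obtain p k l x z where q: "q = (p, k mod 6)" and l: "large p k l x z"
    by (rule flags_cases)
  obtain x' where l': "large (p + l *\<^sub>R D k) (k + 2) l x' (l - x)" using large_rotate[OF l] .
  have "flag_rot q = (p + l *\<^sub>R D k, (k + 2) mod 6)"
    using flag_eqs[OF l] by (simp add: q flag_rot_def D_mod_6 mod_simps)
  then show "flag_rot q \<in> flags" "flag_len (flag_rot q) = flag_len q"
    "flag_z (flag_rot q) = flag_len q - flag_x q"
    using flag_eqs[OF l] flag_eqs[OF l'] by (simp_all add: q)
qed

lemma flag_flip:
  assumes "q \<in> flags"
  shows "flag_flip q \<in> flags" "flag_len (flag_flip q) = flag_x q + flag_z q"
    "flag_x (flag_flip q) = flag_x q"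
proof -
  from assms obtain p k l x z where q: "q = (p, k mod 6)" and l: "large p k l x z"
    by (rule flags_cases)
  obtain z' where l': "large (p - x *\<^sub>R D (k + 2)) (k + 2) (x + z) x z'" using large_flip[OF l] .
  have "flag_flip q = (p - x *\<^sub>R D (k + 2), (k + 2) mod 6)"
    using flag_eqs[OF l] by (simp add: q flag_flip_def D_mod_6 mod_simps)
  then show "flag_flip q \<in> flags" "flag_len (flag_flip q) = flag_x q + flag_z q"
    "flag_x (flag_flip q) = flag_x q"
    using flag_eqs[OF l] flag_eqs[OF l'] by (simp_all add: q)
qed

lemma flag_order_3:
  assumes q: "q \<in> flags"
  shows "flag_rot (flag_rot (flag_rot q)) = q" "flag_flip (flag_flip (flag_flip q)) = q"
    "flag_rot (flag_flip (flag_rot (flag_flip (flag_rot (flag_flip q))))) = q"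
proof -
  have k: "snd q mod 6 = snd q" using q by (auto simp: flags_def)
  define r1 r2 f1 f2 where "r1 = flag_rot q" and "r2 = flag_rot r1"
    and "f1 = flag_flip q" and "f2 = flag_flip f1"
  have inQ: "r1 \<in> flags" "r2 \<in> flags" "f1 \<in> flags" "f2 \<in> flags"
    using q by (simp_all add: r1_def r2_def f1_def f2_def flag_rot flag_flip)
  have len: "flag_len r1 = flag_len q" "flag_len r2 = flag_len q"
    "flag_x f1 = flag_x q" "flag_x f2 = flag_x q"
    using q inQ by (simp_all add: r1_def r2_def f1_def f2_def flag_rot flag_flip)
  have r1: "fst r1 = fst q + flag_len q *\<^sub>R D (snd q)" "snd r1 = (snd q + 2) mod 6"
    by (simp_all add: r1_def flag_rot_def)
  have r2: "fst r2 = fst r1 + flag_len q *\<^sub>R D (snd r1)" "snd r2 = (snd r1 + 2) mod 6"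
    using len by (simp_all add: r2_def flag_rot_def)
  have r3: "fst (flag_rot r2) = fst r2 + flag_len q *\<^sub>R D (snd r2)"
    "snd (flag_rot r2) = (snd r2 + 2) mod 6"
    using len by (simp_all add: flag_rot_def)
  have "flag_rot r2 = q" using k
    by (simp add: prod_eq_iff r3 r2 r1 D_mod_6 mod_simps D_simps algebra_simps)
  then show "flag_rot (flag_rot (flag_rot q)) = q" by (simp add: r1_def r2_def)
  have f1: "fst f1 = fst q - flag_x q *\<^sub>R D (snd q + 2)" "snd f1 = (snd q + 2) mod 6"
    by (simp_all add: f1_def flag_flip_def)
  have f2: "fst f2 = fst f1 - flag_x q *\<^sub>R D (snd f1 + 2)" "snd f2 = (snd f1 + 2) mod 6"
    using len by (simp_all add: f2_def flag_flip_def)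
  have f3: "fst (flag_flip f2) = fst f2 - flag_x q *\<^sub>R D (snd f2 + 2)"
    "snd (flag_flip f2) = (snd f2 + 2) mod 6"
    using len by (simp_all add: flag_flip_def)
  have "flag_flip f2 = q" using k
    by (simp add: prod_eq_iff f3 f2 f1 D_mod_6 mod_simps D_simps algebra_simps)
  then show "flag_flip (flag_flip (flag_flip q)) = q" by (simp add: f1_def f2_def)
  \<comment> \<open>\<open>T\<close> goes round the small tile counterclockwise of the flag: it
    moves by its size \<open>flag_z q\<close>, which it preserves, so three moves add up to
    zero.\<close>
  define T where "T q = flag_rot (flag_flip q)" for q
  have TQ: "T q \<in> flags" and zT: "flag_z (T q) = flag_z q" if "q \<in> flags" for q
    using that by (simp_all add: T_def flag_rot flag_flip)
  have T: "fst (T q) = fst q + flag_z q *\<^sub>R D (snd q + 2)" "snd (T q) = (snd q + 4) mod 6"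
    if "q \<in> flags" for q
    using flag_flip(2)[OF that]
    by (simp_all add: T_def flag_rot_def) (simp_all add: flag_flip_def D_mod_6 mod_simps algebra_simps)
  have "(snd q + 6 * 2) mod 6 = snd q" using k by (simp only: mod_mult_self2)
  then have "T (T (T q)) = q" using q k TQ
    by (simp add: prod_eq_iff T zT D_mod_6 mod_simps D_simps algebra_simps)
  then show "flag_rot (flag_flip (flag_rot (flag_flip (flag_rot (flag_flip q))))) = q"
    by (simp add: T_def)
qed

lemma flag_len_flip:
  assumes q: "q \<in> flags"
  shows "flag_len (flag_flip q) = flag_len q"
proof -
  \<comment> \<open>Each map consists of three moves that raise the direction index by 2 modulo 6,
    so the index is restored, as for a translation.\<close>
  define a b c where "a = (\<lambda>q. flag_rot (flag_rot (flag_flip q)))"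
    and "b = (\<lambda>q. flag_flip (flag_rot (flag_rot q)))"
    and "c = (\<lambda>q. flag_rot (flag_flip (flag_rot q)))"
  have maps: "a q \<in> flags" "b q \<in> flags" "c q \<in> flags" if "q \<in> flags" for q
    using that by (simp_all add: a_def b_def c_def flag_rot flag_flip)
  have comm: "a (b q) = b (a q)" "a (c q) = c (a q)" "b (c q) = c (b q)" "a (b (c q)) = q"
    if "q \<in> flags" for q
    using triangle_group_translations[where Q = flags and R = flag_rot and F = flag_flip and q = q]
      flag_rot(1) flag_flip(1) flag_order_3 that unfolding a_def b_def c_def by blast+
  have pos: "flag_len q > 0" if "q \<in> flags" for q
    using that flag_eqs(2) large_less by (elim flags_cases) fastforce
  \<comment> \<open>Rotations keep the length, so the three values are the sums of the two small
    sizes at the three corners of one large tile. Sorted by sides instead of corners, they add up to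
    one length per side.\<close>
  have harm: "3 * flag_len q = flag_len (a q) + flag_len (b q) + flag_len (c q)" if q: "q \<in> flags" for q
  proof -
    have "flag_z q = flag_len q - flag_x (flag_rot (flag_rot q))"
      using flag_rot(3)[of "flag_rot (flag_rot q)"] q by (simp add: flag_order_3 flag_rot)
    then show ?thesis using q by (simp add: a_def b_def c_def flag_rot flag_flip)
  qed
  have cba: "c (b (a q)) = q" if "q \<in> flags" for q using comm[OF that] maps that comm by metis
  \<comment> \<open>The hypotheses are cyclically symmetric. None of the three values exceeds their
    mean, hence all are equal to it.\<close>
  have a: "flag_len (a q) \<le> flag_len q"
    by (rule harmonic_no_growth[of flags a b c]) (simp_all add: maps pos harm comm(1-3) cba q)
  have b: "flag_len (b q) \<le> flag_len q"
    by (rule harmonic_no_growth[of flags b c a]) (simp_all add: maps pos harm comm(1-3) cba q)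
  have c: "flag_len (c q) \<le> flag_len q"
    by (rule harmonic_no_growth[of flags c a b]) (simp_all add: maps pos harm comm(1-3) cba q)
  have "flag_len (a q) = flag_len q" using a b c harm[OF q] by linarith
  then show ?thesis using q by (simp add: a_def flag_rot flag_flip)
qed

text \<open>Invariance under flips says \<open>x + z = l\<close> at each flag. Compared with the
  value of \<open>z\<close> after a rotation, this gives the same \<open>x\<close> at all three
  corners.\<close>

lemma large_rigid:
  assumes "large p k l x z"
  shows "z = l - x" "large (p + l *\<^sub>R D k) (k + 2) l x (l - x)"
    "large (p - x *\<^sub>R D (k + 2)) (k + 2) l x (l - x)"
proof -
  have len: "flag_x q + flag_z q = flag_len q" if "q \<in> flags" for q
    using flag_len_flip[OF that] that by (simp add: flag_flip)
  have x2: "flag_x (flag_rot (flag_rot q)) = flag_x q" if "q \<in> flags" for q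
    using flag_rot(3)[of "flag_rot (flag_rot q)"] len[OF that] that by (simp add: flag_order_3 flag_rot)
  have x1: "flag_x (flag_rot q) = flag_x q" if "q \<in> flags" for q
    using x2[of "flag_rot q"] that by (simp add: flag_order_3 flag_rot)
  have z: "z = l - x" if "large p k l x z" for p k l x z
    using len[OF flag_eqs(1)[OF that]] flag_eqs[OF that] by simp
  show "z = l - x" by (rule z[OF assms])
  obtain x' where l': "large (p + l *\<^sub>R D k) (k + 2) l x' (l - x)" using large_rotate[OF assms] .
  have "flag_rot (p, k mod 6) = (p + l *\<^sub>R D k, (k + 2) mod 6)"
    using flag_eqs[OF assms] by (simp add: flag_rot_def D_mod_6 mod_simps)
  then have "x' = x" using x1[OF flag_eqs(1)[OF assms]] flag_eqs[OF assms] flag_eqs[OF l'] by simp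
  then show "large (p + l *\<^sub>R D k) (k + 2) l x (l - x)" using l' by simp
  obtain z' where l': "large (p - x *\<^sub>R D (k + 2)) (k + 2) (x + z) x z'" using large_flip[OF assms] .
  then show "large (p - x *\<^sub>R D (k + 2)) (k + 2) l x (l - x)"
    using z[OF l'] z[OF assms] by simp
qed

section \<open>The pattern generated by one large tile and its contacts\<close>

definition mesh where
  "mesh k\<^sub>0 l x p k \<longleftrightarrow> even (k - k\<^sub>0) \<and> large p k l x (l - x)"

lemma mesh_corners:
  assumes "mesh k\<^sub>0 l x p k"
  shows "C p k l" "C p (k + 5) x" "C p (k + 1) (l - x)" "0 < x" "x < l"
  using assms large_less[of p k l x "l - x"] by (auto simp: mesh_def large_def)

lemma mesh_add_6: "mesh k\<^sub>0 l x p (k + 6) \<longleftrightarrow> mesh k\<^sub>0 l x p k"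
  by (simp add: mesh_def large_add_6)

lemma mesh_add: "mesh k\<^sub>0 l x p (k + 7) \<longleftrightarrow> mesh k\<^sub>0 l x p (k + 1)"
  "mesh k\<^sub>0 l x p (k + 8) \<longleftrightarrow> mesh k\<^sub>0 l x p (k + 2)"
  "mesh k\<^sub>0 l x p (k + 9) \<longleftrightarrow> mesh k\<^sub>0 l x p (k + 3)"
  "mesh k\<^sub>0 l x p (k + 10) \<longleftrightarrow> mesh k\<^sub>0 l x p (k + 4)"
  "mesh k\<^sub>0 l x p (k + 11) \<longleftrightarrow> mesh k\<^sub>0 l x p (k + 5)"
  using mesh_add_6[of k\<^sub>0 l x p "k + 1"] mesh_add_6[of k\<^sub>0 l x p "k + 2"]
    mesh_add_6[of k\<^sub>0 l x p "k + 3"] mesh_add_6[of k\<^sub>0 l x p "k + 4"]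
    mesh_add_6[of k\<^sub>0 l x p "k + 5"]
  by (simp_all add: int_num_commute)

lemmas mesh_simps = mesh_add_6 mesh_add hex_simps

lemma mesh_rotate: "mesh k\<^sub>0 l x p k \<Longrightarrow> mesh k\<^sub>0 l x (p + l *\<^sub>R D k) (k + 2)"
  using large_rigid(2)[of p k l x "l - x"] by (simp add: mesh_def)

lemma mesh_flip: "mesh k\<^sub>0 l x p k \<Longrightarrow> mesh k\<^sub>0 l x (p - x *\<^sub>R D (k + 2)) (k + 2)"
  using large_rigid(3)[of p k l x "l - x"] by (simp add: mesh_def)

lemma mesh_rotate2: "mesh k\<^sub>0 l x p k \<Longrightarrow> mesh k\<^sub>0 l x (p + l *\<^sub>R D (k + 1)) (k + 4)"
  using mesh_rotate[OF mesh_rotate, of k\<^sub>0 l x p k] by (simp add: mesh_simps algebra_simps)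

lemma mesh_flip2: "mesh k\<^sub>0 l x p k \<Longrightarrow> mesh k\<^sub>0 l x (p + x *\<^sub>R D k) (k + 4)"
  using mesh_flip[OF mesh_flip, of k\<^sub>0 l x p k] by (simp add: mesh_simps algebra_simps)

lemma mesh_flip': "mesh k\<^sub>0 l x p k \<Longrightarrow> mesh k\<^sub>0 l x (p + (l - x) *\<^sub>R D (k + 2)) (k + 4)"
  using mesh_rotate[OF mesh_flip, of k\<^sub>0 l x p k] by (simp add: mesh_simps algebra_simps)

text \<open>A rotation and a flip whose index shifts add up to 6 give a translation. Both signs
  appear because the tiling must be mapped onto itself, not merely into itself.\<close>

lemma mesh_translate:
  assumes "mesh k\<^sub>0 l x p k"
  shows "mesh k\<^sub>0 l x (p + ((l - x) *\<^sub>R D k + x *\<^sub>R D (k + 1))) k"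
    "mesh k\<^sub>0 l x (p - ((l - x) *\<^sub>R D k + x *\<^sub>R D (k + 1))) k"
    "mesh k\<^sub>0 l x (p + (l *\<^sub>R D (k + 1) - x *\<^sub>R D k)) k"
    "mesh k\<^sub>0 l x (p - (l *\<^sub>R D (k + 1) - x *\<^sub>R D k)) k"
  using mesh_flip2[OF mesh_rotate[OF assms]] mesh_rotate2[OF mesh_flip[OF assms]]
    mesh_flip[OF mesh_rotate2[OF assms]] mesh_rotate[OF mesh_flip2[OF assms]]
  by (simp_all add: mesh_simps algebra_simps)

text \<open>The offset \<open>i\<close> from the corner of the tile to the large corner encodes its
  role: 0 for the large tile, 1 for its clockwise and 5 for its counterclockwise small neighbour. A
  tile has the same role at all its corners.\<close>

lemma tile_rotate:
  assumes "C q j s" "mesh k\<^sub>0 l x q (j + i)" "i \<in> {0, 1, 5}"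
  shows "mesh k\<^sub>0 l x (q + s *\<^sub>R D j) (j + 2 + i)"
proof -
  consider "i = 0" | "i = 1" | "i = 5" using assms(3) by auto
  then show ?thesis
  proof cases
    case 1
    then have "s = l" using mesh_corners(1) assms size_unique by auto
    then show ?thesis using mesh_rotate assms(2) 1 by simp
  next
    case 2
    then have "s = x" using mesh_corners(2)[of k\<^sub>0 l x q "j + 1"] assms size_unique
      by (auto simp: mesh_simps)
    then show ?thesis using mesh_flip[of k\<^sub>0 l x q "j + 1"] assms(2) 2 by (simp add: mesh_simps)
  next
    case 3
    then have "s = l - x" using mesh_corners(3)[of k\<^sub>0 l x q "j + 5"] assms size_unique
      by (auto simp: mesh_simps)
    have "mesh k\<^sub>0 l x (q + (l - x) *\<^sub>R D (j + 5 + 2) + (l - x) *\<^sub>R D (j + 5 + 4 + 2)) (j + 5 + 4 + 4)"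
      using mesh_flip'[OF mesh_flip'] assms(2) 3 by blast
    also have "q + (l - x) *\<^sub>R D (j + 5 + 2) + (l - x) *\<^sub>R D (j + 5 + 4 + 2) = q + s *\<^sub>R D j"
      unfolding \<open>s = l - x\<close> by (simp add: hex_simps algebra_simps)
    also have "j + 5 + 4 + 4 = j + 2 + i + 6" using 3 by simp
    finally show ?thesis unfolding mesh_add_6 .
  qed
qed

text \<open>The mesh predicts the tile across the side, and uniqueness of sides identifies it with
  the given one. Opposite a large tile it is the small tile of size \<open>x\<close> or
  \<open>l - x\<close>, according to the position of \<open>z\<close>; opposite a small tile it is a
  large one.\<close>

lemma mesh_contact:
  assumes mesh: "mesh k\<^sub>0 l x (z - t *\<^sub>R D m) (m + i)" and i: "i \<in> {0, 1, 5}"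
    and s: "S z m t s" and s': "S z (m + 3) t' s'"
  shows "\<exists>i\<in>{0, 1, 5}. mesh k\<^sub>0 l x (z - t' *\<^sub>R D (m + 3)) (m + 3 + i)"
proof -
  define q where "q = z - t *\<^sub>R D m"
  have z: "z = q + t *\<^sub>R D m" by (simp add: q_def)
  have t: "0 < t" "t < s" and c: "C q m s" using s by (auto simp: side_at_def q_def)
  consider "i = 0" | "i = 1" | "i = 5" using i by auto
  then show ?thesis
  proof cases
    case 1
    then have h: "mesh k\<^sub>0 l x q m" using mesh q_def by simp
    note h' = mesh_corners[OF h]
    have sl: "s = l" using size_unique c h' by blast
    consider "t < x" | "t = x" | "x < t" by linarith
    then show ?thesis
    proof cases
      case 1
      have "S z (m + 3) (x - t) x" using rotate2[OF h'(2)] t 1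
        by (simp add: side_at_def z mesh_simps algebra_simps)
      then have t': "t' = x - t" using side_unique[OF s'] by blast
      have "z - t' *\<^sub>R D (m + 3) = q + x *\<^sub>R D m" unfolding t' by (simp add: z hex_simps algebra_simps)
      then show ?thesis using mesh_flip2[OF h] by (intro bexI[of _ 1]) (simp_all add: add.commute)
    next
      case 2
      then have "C z (m + 3) x" using rotate2[OF h'(2)] by (simp add: z mesh_simps)
      then show ?thesis using corner_not_side[OF s', of 0] by simp
    next
      case 3
      define e where "e = q + l *\<^sub>R D m"
      have he: "mesh k\<^sub>0 l x e (m + 2)" using mesh_rotate[OF h] e_def by simp
      have "S z (m + 3) (l - t) (l - x)" using mesh_corners(3)[OF he] t 3
        by (simp add: side_at_def z e_def sl mesh_simps algebra_simps)
      then have t': "t' = l - t" using side_unique[OF s'] by blast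
      have "z - t' *\<^sub>R D (m + 3) = e" unfolding t' by (simp add: z e_def hex_simps algebra_simps)
      then show ?thesis using he by (intro bexI[of _ 5]) (simp_all add: mesh_simps)
    qed
  next
    case 2
    then have h: "mesh k\<^sub>0 l x q (m + 1)" using mesh q_def by simp
    have "s = x" using mesh_corners(2)[OF h] size_unique[OF c] by (simp add: mesh_simps)
    define e where "e = q + x *\<^sub>R D m"
    have he: "mesh k\<^sub>0 l x e (m + 3)" using mesh_flip[OF h] by (simp add: e_def mesh_simps)
    have "S z (m + 3) (x - t) l" using mesh_corners[OF he] t \<open>s = x\<close>
      by (simp add: side_at_def z e_def hex_simps algebra_simps)
    then have t': "t' = x - t" using side_unique[OF s'] by blast
    have "z - t' *\<^sub>R D (m + 3) = e" unfolding t' by (simp add: z e_def hex_simps algebra_simps)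
    then show ?thesis using he by (intro bexI[of _ 0]) simp_all
  next
    case 3
    then have h: "mesh k\<^sub>0 l x q (m + 5)" using mesh q_def by simp
    note h' = mesh_corners[OF h]
    have sy: "s = l - x" using h'(3) size_unique[OF c] by (simp add: mesh_simps)
    define e where "e = q + l *\<^sub>R D m"
    have he: "mesh k\<^sub>0 l x e (m + 3)" using mesh_rotate2[OF h] by (simp add: e_def mesh_simps)
    have "S z (m + 3) (l - t) l" using mesh_corners[OF he] t sy
      by (simp add: side_at_def z e_def hex_simps algebra_simps)
    then have t': "t' = l - t" using side_unique[OF s'] by blast
    have "z - t' *\<^sub>R D (m + 3) = e" unfolding t' by (simp add: z e_def hex_simps algebra_simps)
    then show ?thesis using he by (intro bexI[of _ 0]) simp_all
  qed
qed

end

section \<open>Geometry of equilateral tilings\<close>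

definition equi_frame :: "real^2 \<Rightarrow> real^2 \<Rightarrow> bool" where
  "equi_frame u v \<longleftrightarrow> u \<noteq> 0 \<and> norm v = norm u \<and> norm (v - u) = norm u"

definition triangle :: "real^2 \<Rightarrow> real^2 \<Rightarrow> real^2 \<Rightarrow> (real^2) set" where
  "triangle p u v = convex hull {p, p + u, p + v}"

lemma triangle_eq: "triangle p u v = {p + a *\<^sub>R u + b *\<^sub>R v | a b. 0 \<le> a \<and> 0 \<le> b \<and> a + b \<le> 1}"
  unfolding triangle_def convex_hull_3_alt by simp

lemma triangle_rotate: "triangle p u v = triangle (p + u) (v - u) (- u)"
  unfolding triangle_def by (simp add: insert_commute algebra_simps)

lemma triangle_swap: "triangle p u v = triangle p v u"
  unfolding triangle_def by (simp add: insert_commute)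

lemma equi_frame_rotate: "equi_frame u v \<Longrightarrow> equi_frame (v - u) (- u)"
  unfolding equi_frame_def by (auto simp: norm_minus_commute)

lemma equi_frame_swap: "equi_frame u v \<Longrightarrow> equi_frame v u"
  unfolding equi_frame_def by (auto simp: norm_minus_commute)

lemma equi_frame_scale: "equi_frame u v \<Longrightarrow> c \<noteq> 0 \<Longrightarrow> equi_frame (c *\<^sub>R u) (c *\<^sub>R v)"
  unfolding equi_frame_def by (simp flip: scaleR_diff_right)

lemma equi_frame_inner:
  assumes "equi_frame u v"
  shows "u \<bullet> u = (norm u)\<^sup>2" "v \<bullet> v = (norm u)\<^sup>2" "u \<bullet> v = (norm u)\<^sup>2 / 2" "v \<bullet> u = (norm u)\<^sup>2 / 2"
proof -
  show 1: "u \<bullet> u = (norm u)\<^sup>2" "v \<bullet> v = (norm u)\<^sup>2"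
    using assms by (simp_all add: equi_frame_def flip: power2_norm_eq_inner)
  have "(v - u) \<bullet> (v - u) = (norm u)\<^sup>2" using assms by (simp add: equi_frame_def flip: power2_norm_eq_inner)
  then show "u \<bullet> v = (norm u)\<^sup>2 / 2" "v \<bullet> u = (norm u)\<^sup>2 / 2"
    using 1 by (simp_all add: inner_diff inner_commute)
qed

lemma equi_frame_norm:
  assumes "equi_frame u v"
  shows "(norm (a *\<^sub>R u + b *\<^sub>R v))\<^sup>2 = (norm u)\<^sup>2 * (a\<^sup>2 + a * b + b\<^sup>2)"
  unfolding power2_norm_eq_inner[of "a *\<^sub>R u + b *\<^sub>R v"]
  by (simp add: inner_add equi_frame_inner[OF assms]) (simp add: power2_eq_square algebra_simps)

text \<open>The form is the squared norm in an equilateral frame. Four times it exceeds the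
  left-hand sides by the squares of \<open>a + 2 * b\<close>, \<open>2 * a + b\<close> and
  \<open>a - b\<close>; so a short vector changes all three barycentric coordinates little.\<close>

lemma eisenstein_bounds:
  fixes a b :: real
  shows "3 * a\<^sup>2 \<le> 4 * (a\<^sup>2 + a * b + b\<^sup>2)" "3 * b\<^sup>2 \<le> 4 * (a\<^sup>2 + a * b + b\<^sup>2)"
    "3 * (a + b)\<^sup>2 \<le> 4 * (a\<^sup>2 + a * b + b\<^sup>2)"
proof -
  have "(a + 2 * b)\<^sup>2 \<ge> 0" "(2 * a + b)\<^sup>2 \<ge> 0" "(a - b)\<^sup>2 \<ge> 0" by simp_all
  then show "3 * a\<^sup>2 \<le> 4 * (a\<^sup>2 + a * b + b\<^sup>2)" "3 * b\<^sup>2 \<le> 4 * (a\<^sup>2 + a * b + b\<^sup>2)"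
    "3 * (a + b)\<^sup>2 \<le> 4 * (a\<^sup>2 + a * b + b\<^sup>2)"
    by (simp_all add: power2_eq_square algebra_simps)
qed

lemma equi_frame_zero:
  assumes "equi_frame u v" "a *\<^sub>R u + b *\<^sub>R v = 0"
  shows "a = 0 \<and> b = 0"
proof -
  have "(norm u)\<^sup>2 * (a\<^sup>2 + a * b + b\<^sup>2) = 0" using equi_frame_norm[OF assms(1), of a b] assms(2) by simp
  then have "a\<^sup>2 + a * b + b\<^sup>2 = 0" using assms(1) by (simp add: equi_frame_def)
  then have "a\<^sup>2 \<le> 0" "b\<^sup>2 \<le> 0" using eisenstein_bounds[of a b] by simp_all
  then show ?thesis by simp
qed

lemma equi_frame_unique:
  assumes "equi_frame u v" "a *\<^sub>R u + b *\<^sub>R v = a' *\<^sub>R u + b' *\<^sub>R v"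
  shows "a = a' \<and> b = b'"
  using equi_frame_zero[OF assms(1), of "a - a'" "b - b'"] assms(2) by (simp add: algebra_simps)

lemma equi_frame_independent:
  assumes "equi_frame u v"
  shows "u \<noteq> v" "independent {u, v}"
proof -
  show uv: "u \<noteq> v" using assms by (auto simp: equi_frame_def)
  show "independent {u, v}"
  proof (rule independent_if_scalars_zero)
    fix f x assume f: "(\<Sum>x\<in>{u, v}. f x *\<^sub>R x) = 0" "x \<in> {u, v}"
    then have "f u *\<^sub>R u + f v *\<^sub>R v = 0" using uv by simp
    from equi_frame_zero[OF assms this] show "f x = 0" using f(2) by auto
  qed simp
qed

lemma equi_frame_span:
  assumes "equi_frame u v"
  obtains a b where "x = a *\<^sub>R u + b *\<^sub>R v"
proof -
  have "card {u, v} = DIM(real^2)" using equi_frame_independent[OF assms] by simp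
  then have "UNIV \<subseteq> span {u, v}"
    using card_ge_dim_independent[of "{u, v}" UNIV] equi_frame_independent[OF assms] by simp
  then have "x \<in> span {u, v}" by blast
  then obtain a b where "x - a *\<^sub>R u = b *\<^sub>R v" by (auto simp: span_insert span_singleton)
  then show thesis using that[of a b] by (simp add: algebra_simps)
qed

lemma equi_frame_small:
  assumes "equi_frame u v" "norm (a *\<^sub>R u + b *\<^sub>R v) < c * norm u / 4"
  shows "\<bar>a\<bar> < c / 3" "\<bar>b\<bar> < c / 3" "\<bar>a + b\<bar> < c / 3"
proof -
  let ?Q = "a\<^sup>2 + a * b + b\<^sup>2"
  have u: "norm u > 0" using assms(1) by (simp add: equi_frame_def)
  have "0 \<le> norm (a *\<^sub>R u + b *\<^sub>R v)" by simp
  then have "0 < c * norm u / 4" using assms(2) by linarith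
  then have c: "c > 0" using u by (simp add: zero_less_mult_iff)
  have "(norm u)\<^sup>2 * ?Q < (c * norm u / 4)\<^sup>2"
    unfolding equi_frame_norm[OF assms(1), symmetric] using assms(2) by (intro power_strict_mono) auto
  then have "(norm u)\<^sup>2 * ?Q < (norm u)\<^sup>2 * (c\<^sup>2 / 16)" by (simp add: power_mult_distrib power_divide mult.commute)
  then have Q: "?Q < c\<^sup>2 / 16" using u by (simp add: mult_less_cancel_left_pos)
  have *: "\<bar>x\<bar> < c / 3" if "3 * x\<^sup>2 \<le> 4 * ?Q" for x
  proof (rule power2_less_imp_less)
    have "X < C / 9" if "3 * X \<le> 4 * q" "q < C / 16" "0 < C" for X q C :: real
      using that by linarith
    from this[OF that Q] have "x\<^sup>2 < c\<^sup>2 / 9" using c by simp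
    then show "\<bar>x\<bar>\<^sup>2 < (c / 3)\<^sup>2" by (simp add: power_divide)
  qed (use c in simp)
  show "\<bar>a\<bar> < c / 3" "\<bar>b\<bar> < c / 3" "\<bar>a + b\<bar> < c / 3"
    by (intro * eisenstein_bounds)+
qed

lemma triangle_ball:
  assumes uv: "equi_frame u v" and m: "m > 0" "m / 3 \<le> a" "m / 3 \<le> b" "a + b \<le> 1 - m / 3"
  shows "ball (p + a *\<^sub>R u + b *\<^sub>R v) (m * norm u / 4) \<subseteq> triangle p u v"
proof
  fix z assume z: "z \<in> ball (p + a *\<^sub>R u + b *\<^sub>R v) (m * norm u / 4)"
  obtain a' b' where w: "z - (p + a *\<^sub>R u + b *\<^sub>R v) = a' *\<^sub>R u + b' *\<^sub>R v" using equi_frame_span[OF uv] .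
  have "norm (a' *\<^sub>R u + b' *\<^sub>R v) < m * norm u / 4"
    using z by (simp flip: w add: dist_norm norm_minus_commute)
  note s = equi_frame_small[OF uv this]
  have "z = p + (a + a') *\<^sub>R u + (b + b') *\<^sub>R v" using w by (simp add: algebra_simps)
  moreover have "0 \<le> a + a'" "0 \<le> b + b'" "a + a' + (b + b') \<le> 1" using s m by linarith+
  ultimately show "z \<in> triangle p u v" unfolding triangle_eq by blast
qed

lemma triangle_interior:
  assumes "equi_frame u v" "a > 0" "b > 0" "a + b < 1"
  shows "p + a *\<^sub>R u + b *\<^sub>R v \<in> interior (triangle p u v)"
proof -
  define m where "m = min a (min b (1 - a - b))"
  have m: "m > 0" using assms by (auto simp: m_def)
  have "ball (p + a *\<^sub>R u + b *\<^sub>R v) (m * norm u / 4) \<subseteq> triangle p u v"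
  proof (rule triangle_ball)
    have "m \<le> a" "m \<le> b" "m \<le> 1 - a - b" by (auto simp: m_def)
    then show "m / 3 \<le> a" "m / 3 \<le> b" "a + b \<le> 1 - m / 3" using m by linarith+
  qed (use assms m in auto)
  moreover have "m * norm u / 4 > 0" using m assms(1) by (simp add: equi_frame_def)
  ultimately show ?thesis unfolding mem_interior by blast
qed

text \<open>Serves to recognise tiles near a point without angles: tiles with a common germ have a
  common interior point and are therefore equal.\<close>

definition germ :: "(real^2) set \<Rightarrow> real^2 \<Rightarrow> real^2 \<Rightarrow> bool" where
  "germ T z w \<longleftrightarrow> (\<exists>\<epsilon>>0. \<forall>\<tau>. 0 < \<tau> \<and> \<tau> < \<epsilon> \<longrightarrow> z + \<tau> *\<^sub>R w \<in> interior T)"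

lemma germ_common:
  assumes "germ S z w" "germ T z w"
  shows "interior S \<inter> interior T \<noteq> {}"
proof -
  obtain e e' where e: "e > 0" "e' > 0" "\<And>\<tau>. 0 < \<tau> \<Longrightarrow> \<tau> < e \<Longrightarrow> z + \<tau> *\<^sub>R w \<in> interior S"
    "\<And>\<tau>. 0 < \<tau> \<Longrightarrow> \<tau> < e' \<Longrightarrow> z + \<tau> *\<^sub>R w \<in> interior T"
    using assms unfolding germ_def by blast
  define \<tau> where "\<tau> = min e e' / 2"
  have "0 < \<tau>" "\<tau> < e" "\<tau> < e'" using e by (auto simp: \<tau>_def)
  then show ?thesis using e by blast
qed

lemma stays_positive:
  fixes a x :: real
  assumes "a \<ge> 0" "a = 0 \<Longrightarrow> x > 0"
  shows "\<exists>e>0. \<forall>\<tau>. 0 < \<tau> \<and> \<tau> < e \<longrightarrow> a + \<tau> * x > 0"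
proof (cases "a = 0")
  case True
  then show ?thesis using assms by (intro exI[of _ 1]) auto
next
  case False
  then have a: "a > 0" using assms by simp
  show ?thesis
  proof (intro exI[of _ "a / (\<bar>x\<bar> + 1)"] conjI allI impI)
    show "a / (\<bar>x\<bar> + 1) > 0" using a by (simp add: add_nonneg_pos)
    fix \<tau> assume "0 < \<tau> \<and> \<tau> < a / (\<bar>x\<bar> + 1)"
    then have t: "0 < \<tau>" "\<tau> * (\<bar>x\<bar> + 1) < a" by (auto simp: less_divide_eq add_nonneg_pos)
    have "\<tau> * (- x) \<le> \<tau> * (\<bar>x\<bar> + 1)" using t by (intro mult_left_mono) auto
    then show "a + \<tau> * x > 0" using t by simp
  qed
qed

text \<open>Only barycentric coordinates that vanish at the point restrict the direction; the
  positive ones stay positive for a short while.\<close>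

lemma triangle_germ:
  assumes uv: "equi_frame u v" and ab: "0 \<le> a" "0 \<le> b" "a + b \<le> 1"
    and w: "a = 0 \<Longrightarrow> \<alpha> > 0" "b = 0 \<Longrightarrow> \<beta> > 0" "a + b = 1 \<Longrightarrow> \<alpha> + \<beta> < 0"
  shows "germ (triangle p u v) (p + a *\<^sub>R u + b *\<^sub>R v) (\<alpha> *\<^sub>R u + \<beta> *\<^sub>R v)"
proof -
  obtain e1 where e1: "e1 > 0" "\<And>\<tau>. 0 < \<tau> \<Longrightarrow> \<tau> < e1 \<Longrightarrow> a + \<tau> * \<alpha> > 0"
    using stays_positive[OF ab(1) w(1)] by blast
  obtain e2 where e2: "e2 > 0" "\<And>\<tau>. 0 < \<tau> \<Longrightarrow> \<tau> < e2 \<Longrightarrow> b + \<tau> * \<beta> > 0"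
    using stays_positive[OF ab(2) w(2)] by blast
  have "\<exists>e>0. \<forall>\<tau>. 0 < \<tau> \<and> \<tau> < e \<longrightarrow> (1 - a - b) + \<tau> * (- \<alpha> - \<beta>) > 0"
    by (rule stays_positive) (use ab w(3) in auto)
  then obtain e3 where e3: "e3 > 0"
    "\<And>\<tau>. 0 < \<tau> \<Longrightarrow> \<tau> < e3 \<Longrightarrow> (1 - a - b) + \<tau> * (- \<alpha> - \<beta>) > 0" by blast
  show ?thesis unfolding germ_def
  proof (intro exI[of _ "min e1 (min e2 e3)"] conjI allI impI)
    show "min e1 (min e2 e3) > 0" using e1 e2 e3 by simp
    fix \<tau> assume t: "0 < \<tau> \<and> \<tau> < min e1 (min e2 e3)"
    have "(1 - a - b) + \<tau> * (- \<alpha> - \<beta>) > 0" using e3(2) t by auto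
    then have "p + (a + \<tau> * \<alpha>) *\<^sub>R u + (b + \<tau> * \<beta>) *\<^sub>R v \<in> interior (triangle p u v)"
      using e1(2)[of \<tau>] e2(2)[of \<tau>] t by (intro triangle_interior uv) (auto simp: algebra_simps)
    then show "p + a *\<^sub>R u + b *\<^sub>R v + \<tau> *\<^sub>R (\<alpha> *\<^sub>R u + \<beta> *\<^sub>R v) \<in> interior (triangle p u v)"
      by (simp add: algebra_simps)
  qed
qed

section \<open>Vertices, edges and position of equilateral triangles\<close>

lemma triangle_independent:
  assumes "equi_frame u v"
  shows "\<not> affine_dependent {p, p + u, p + v}"
proof -
  have "u \<noteq> 0" "v \<noteq> 0" using assms by (auto simp: equi_frame_def)
  then have "p \<notin> {p + u, p + v}" by auto
  moreover have "(\<lambda>x. x - p) ` {p + u, p + v} = {u, v}" by auto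
  ultimately show ?thesis
    using affine_dependent_iff_dependent[of p "{p + u, p + v}"] equi_frame_independent[OF assms] by simp
qed

lemma triangle_extreme: "equi_frame u v \<Longrightarrow> x extreme_point_of triangle p u v \<longleftrightarrow> x \<in> {p, p + u, p + v}"
  unfolding triangle_def by (rule extreme_point_of_convex_hull_affine_independent[OF triangle_independent])

lemma triangle_edge: "equi_frame u v \<Longrightarrow> closed_segment p (p + u) edge_of triangle p u v"
  unfolding edge_of_def triangle_def face_of_convex_hull_affine_independent[OF triangle_independent]
  by (auto simp: segment_convex_hull aff_dim_convex_hull equi_frame_def intro!: exI[of _ "{p, p + u}"])

lemma triangle_edge_length:
  assumes uv: "equi_frame u v" and e: "closed_segment x y edge_of triangle p u v"
  shows "dist x y = norm u"
proof -
  have "x extreme_point_of triangle p u v" "y extreme_point_of triangle p u v" "x \<noteq> y"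
    using e extreme_point_of_face[of "closed_segment x y" "triangle p u v"]
    by (auto simp: edge_of_def extreme_point_of_segment)
  then show ?thesis using uv unfolding triangle_extreme[OF uv]
    by (auto simp: dist_norm equi_frame_def norm_minus_commute algebra_simps)
qed

lemma equilateral_frame:
  assumes "equilateral_triangle T"
  obtains p u v where "equi_frame u v" "T = triangle p u v"
proof -
  obtain p q r where *: "p \<noteq> q" "dist p q = dist q r" "dist q r = dist r p" "T = convex hull {p, q, r}"
    using assms by (auto simp: equilateral_triangle_def)
  then have "equi_frame (q - p) (r - p)" by (auto simp: equi_frame_def dist_norm norm_minus_commute)
  moreover have "T = triangle p (q - p) (r - p)" using * by (simp add: triangle_def)
  ultimately show thesis by (rule that)
qed

text \<open>Moving \<open>y\<close> towards the centroid by the fraction \<open>l\<close> gains the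
  margin \<open>l / 3\<close> in every barycentric coordinate. For large triangles a small
  \<open>l\<close> keeps the ball close to \<open>y\<close>.\<close>

lemma triangle_centre_ball:
  assumes uv: "equi_frame u v" and y: "y \<in> triangle p u v" and l: "0 < l" "l \<le> 1"
  obtains g where "ball g (l * norm u / 4) \<subseteq> triangle p u v" "dist y g \<le> 2 * l * norm u"
proof -
  obtain a b where ab: "y = p + a *\<^sub>R u + b *\<^sub>R v" "0 \<le> a" "0 \<le> b" "a + b \<le> 1"
    using y unfolding triangle_eq by blast
  define a' b' where "a' = a + l * (1 / 3 - a)" and "b' = b + l * (1 / 3 - b)"
  have "(1 - l) * a \<ge> 0" "(1 - l) * b \<ge> 0" "(1 - l) * (a + b) \<le> (1 - l) * 1"
    using ab l by simp_all (rule mult_left_mono[of "a + b" 1 "1 - l", simplified], auto)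
  then have "l / 3 \<le> a'" "l / 3 \<le> b'" "a' + b' \<le> 1 - l / 3"
    by (simp_all add: a'_def b'_def algebra_simps)
  then have "ball (p + a' *\<^sub>R u + b' *\<^sub>R v) (l * norm u / 4) \<subseteq> triangle p u v"
    using triangle_ball[OF uv l(1)] by blast
  moreover have "dist y (p + a' *\<^sub>R u + b' *\<^sub>R v) \<le> 2 * l * norm u"
  proof -
    have "dist y (p + a' *\<^sub>R u + b' *\<^sub>R v) = norm ((l * (1 / 3 - a)) *\<^sub>R u + (l * (1 / 3 - b)) *\<^sub>R v)"
      by (simp add: ab(1) a'_def b'_def dist_norm norm_minus_commute algebra_simps)
    also have "\<dots> \<le> norm ((l * (1 / 3 - a)) *\<^sub>R u) + norm ((l * (1 / 3 - b)) *\<^sub>R v)"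
      by (rule norm_triangle_ineq)
    also have "\<dots> = l * \<bar>1 / 3 - a\<bar> * norm u + l * \<bar>1 / 3 - b\<bar> * norm u"
      using uv l by (simp add: equi_frame_def abs_mult)
    also have "\<dots> \<le> l * 1 * norm u + l * 1 * norm u"
      using ab l by (intro add_mono mult_right_mono mult_left_mono) auto
    finally show ?thesis by simp
  qed
  ultimately show thesis by (rule that)
qed

text \<open>Vertices can be discarded, since the complement of a countable set in the plane is connected.\<close>

lemma connected_off_countable:
  fixes \<T> \<S> :: "(real^2) set set"
  assumes fin: "\<And>x. finite {T \<in> \<T>. T \<inter> cball x 1 \<noteq> {}}"
    and clo: "\<And>T. T \<in> \<T> \<Longrightarrow> closed T" and int: "\<And>T. T \<in> \<T> \<Longrightarrow> interior T \<noteq> {}"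
    and un: "\<Union>\<T> = UNIV" and V: "countable V"
    and S: "\<S> \<subseteq> \<T>" "\<S> \<noteq> {}"
    and contact: "\<And>A T z. A \<in> \<S> \<Longrightarrow> T \<in> \<T> \<Longrightarrow> z \<in> A \<Longrightarrow> z \<in> T \<Longrightarrow> z \<notin> V \<Longrightarrow> T \<in> \<S>"
  shows "\<S> = \<T>"
proof (rule ccontr)
  assume "\<S> \<noteq> \<T>"
  have clU: "closed (\<Union>\<A>)" if "\<A> \<subseteq> \<T>" for \<A>
  proof -
    have "locally_finite_in euclidean \<A>"
      unfolding locally_finite_in_def
    proof (intro conjI ballI)
      fix x :: "real^2"
      have "{U \<in> \<A>. U \<inter> ball x 1 \<noteq> {}} \<subseteq> {T \<in> \<T>. T \<inter> cball x 1 \<noteq> {}}"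
        using that ball_subset_cball[of x 1] by blast
      then have "finite {U \<in> \<A>. U \<inter> ball x 1 \<noteq> {}}" using fin finite_subset by blast
      then show "\<exists>V. openin euclidean V \<and> x \<in> V \<and> finite {U \<in> \<A>. U \<inter> V \<noteq> {}}"
        by (intro exI[of _ "ball x 1"]) auto
    qed auto
    then have "closedin euclidean (\<Union>\<A>)"
      using clo that by (intro closedin_locally_finite_Union) auto
    then show ?thesis by simp
  qed
  have notV: "T \<inter> - V \<noteq> {}" if T: "T \<in> \<T>" for T
  proof
    assume "T \<inter> - V = {}"
    then have "T \<subseteq> V" by blast
    obtain x where "x \<in> interior T" using int[OF T] by blast
    then obtain e where "e > 0" "ball x e \<subseteq> T" unfolding mem_interior by blast
    then show False
      using uncountable_ball[of e x] countable_subset[of "ball x e" V] \<open>T \<subseteq> V\<close> V by simp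
  qed
  have "connected (- V)"
    using path_connected_complement_countable[OF _ V] path_connected_imp_connected by auto
  moreover have "closed (\<Union>\<S>)" "closed (\<Union>(\<T> - \<S>))" using clU S by auto
  moreover have "- V \<subseteq> \<Union>\<S> \<union> \<Union>(\<T> - \<S>)" using un by blast
  moreover have "\<Union>\<S> \<inter> \<Union>(\<T> - \<S>) \<inter> - V = {}" using contact by blast
  moreover have "\<Union>\<S> \<inter> - V \<noteq> {}" using S notV by blast
  moreover have "\<Union>(\<T> - \<S>) \<inter> - V \<noteq> {}" using \<open>\<S> \<noteq> \<T>\<close> S notV by blast
  ultimately show False unfolding connected_closed by blast
qed

text \<open>On a given base there are only two equilateral triangles. In coordinates, the inner
  product with \<open>u'\<close> determines \<open>a\<close> from \<open>b\<close>, and the norm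
  then leaves \<open>b = x\<close> or \<open>b = - x\<close>.\<close>

lemma side_contact_frame:
  assumes uv: "equi_frame u v" and uv': "equi_frame u' v'" and u': "u' = x *\<^sub>R u"
  shows "v' = x *\<^sub>R v \<or> v' = x *\<^sub>R (u - v)"
proof -
  obtain a b where v': "v' = a *\<^sub>R u + b *\<^sub>R v" using equi_frame_span[OF uv] .
  let ?n = "(norm u)\<^sup>2"
  have n: "?n > 0" using uv by (simp add: equi_frame_def)
  have nn: "(norm u')\<^sup>2 = x\<^sup>2 * ?n" by (simp add: u' power_mult_distrib)
  have "u' \<bullet> v' = x\<^sup>2 * ?n / 2" using equi_frame_inner(3)[OF uv'] nn by simp
  moreover have "u' \<bullet> v' = ?n * (x * (a + b / 2))"
    by (simp add: u' v' inner_add_right equi_frame_inner[OF uv] algebra_simps)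
  ultimately have "?n * (x * (a + b / 2)) = ?n * (x\<^sup>2 / 2)" by (simp add: mult.commute)
  moreover have n0: "?n \<noteq> 0" using n by simp
  ultimately have "x * (a + b / 2) = x\<^sup>2 / 2" using mult_left_cancel[OF n0] by blast
  then have "x * (a + b / 2) = x * (x / 2)" by (simp add: power2_eq_square)
  moreover have x0: "x \<noteq> 0" using uv' u' by (auto simp: equi_frame_def)
  ultimately have "a + b / 2 = x / 2" using mult_left_cancel[OF x0] by blast
  then have a: "a = (x - b) / 2" by (simp add: field_simps)
  have "(norm v')\<^sup>2 = x\<^sup>2 * ?n" using uv' nn by (simp add: equi_frame_def)
  then have "?n * (a\<^sup>2 + a * b + b\<^sup>2) = ?n * x\<^sup>2" using equi_frame_norm[OF uv, of a b] v' by (simp add: mult.commute)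
  then have "a\<^sup>2 + a * b + b\<^sup>2 = x\<^sup>2" using n by simp
  then have "b\<^sup>2 = x\<^sup>2" unfolding a by (simp add: power2_eq_square field_simps)
  then have "b = x \<or> b = - x" by (simp add: power2_eq_iff)
  then show ?thesis unfolding v' a by (auto simp: algebra_simps)
qed

lemma triangle_boundary_cases:
  assumes uv: "equi_frame u v" and z: "z \<in> triangle p u v"
  obtains "z \<in> interior (triangle p u v)" | "z \<in> {p, p + u, p + v}"
  | p' u' v' a where "triangle p' u' v' = triangle p u v" "equi_frame u' v'" "(p', u', v') \<in>
      {(p, u, v), (p + u, v - u, - u), (p + v, - v, u - v)}" "z = p' + a *\<^sub>R u'" "0 < a" "a < 1"
proof -
  obtain a b where ab: "z = p + a *\<^sub>R u + b *\<^sub>R v" "0 \<le> a" "0 \<le> b" "a + b \<le> 1"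
    using z unfolding triangle_eq by blast
  have r: "triangle (p + u) (v - u) (- u) = triangle p u v" "triangle (p + v) (- v) (u - v) = triangle p u v"
    "equi_frame (v - u) (- u)" "equi_frame (- v) (u - v)"
    using triangle_rotate[of p u v] triangle_rotate[of "p + u" "v - u" "- u"] equi_frame_rotate[OF uv]
      equi_frame_rotate[OF equi_frame_rotate[OF uv]] by (auto simp: algebra_simps)
  consider "a > 0" "b > 0" "a + b < 1" | "a = 0" "b = 0" | "a = 1" "b = 0" | "a = 0" "b = 1"
    | "b = 0" "0 < a" "a < 1" | "a + b = 1" "0 < b" "b < 1" | "a = 0" "0 < 1 - b" "1 - b < 1"
    using ab by argo
  then show thesis
  proof cases
    case 1
    then show thesis using that(1) triangle_interior[OF uv] ab by blast
  next
    case 5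
    then show thesis using ab uv by (intro that(3)[of p u v a]) auto
  next
    case 6
    then have a: "a = 1 - b" by simp
    have "z = p + u + b *\<^sub>R (v - u)" unfolding ab(1) a by (simp add: algebra_simps)
    then show thesis using 6 r by (intro that(3)[of "p + u" "v - u" "- u" b]) auto
  next
    case 7
    then have "z = p + v + (1 - b) *\<^sub>R (- v)" using ab(1) by (simp add: algebra_simps)
    then show thesis using 7 r by (intro that(3)[of "p + v" "- v" "u - v" "1 - b"]) auto
  qed (use that(2) ab(1) in auto)
qed

section \<open>Local finiteness and contacts between tiles\<close>

locale equilateral_tiling =
  fixes \<T> :: "(real^2) set set" and \<delta> :: real
  assumes tiles: "tiles \<T> UNIV"
    and equilateral: "\<And>T. T \<in> \<T> \<Longrightarrow> equilateral_triangle T"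
    and \<delta>_pos: "\<delta> > 0" and \<delta>: "\<And>l. l \<in> side_lengths \<T> \<Longrightarrow> \<delta> \<le> l"
    and no_shared_side: "\<And>S T. S \<in> \<T> \<Longrightarrow> T \<in> \<T> \<Longrightarrow> S \<noteq> T \<Longrightarrow> \<not> share_side S T"
begin

lemma tile_props:
  assumes "T \<in> \<T>"
  shows "compact T" "convex T" "interior T \<noteq> {}" "closed T"
  using assms tiles compact_imp_closed by (auto simp: tiles_def)

lemma tile_eqI: "S \<in> \<T> \<Longrightarrow> T \<in> \<T> \<Longrightarrow> interior S \<inter> interior T \<noteq> {} \<Longrightarrow> S = T"
  using tiles unfolding tiles_def pairwise_def by blast

lemma tile_germ_eqI: "S \<in> \<T> \<Longrightarrow> T \<in> \<T> \<Longrightarrow> germ S z w \<Longrightarrow> germ T z w \<Longrightarrow> S = T"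
  using tile_eqI germ_common by blast

text \<open>A tile lies in the closure of its interior, so an open set meeting the tile also meets
  its interior.\<close>

lemma tile_interior_eqI:
  assumes "S \<in> \<T>" "T \<in> \<T>" "z \<in> interior S" "z \<in> T"
  shows "S = T"
proof (rule tile_eqI)
  have "z \<in> closure (interior T)"
    unfolding convex_closure_interior[OF tile_props(2,3)[OF assms(2)]]
    using assms(4) closure_subset[of T] by blast
  then show "interior S \<inter> interior T \<noteq> {}"
    using assms(3) open_Int_closure_eq_empty[OF open_interior[of S], of "interior T"] by blast
qed (use assms in auto)

lemma tile_frame:
  assumes "T \<in> \<T>"
  obtains p u v where "equi_frame u v" "T = triangle p u v"
  using equilateral_frame[OF equilateral[OF assms]] .

lemma tile_size:
  assumes "triangle p u v \<in> \<T>" "equi_frame u v"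
  shows "\<delta> \<le> norm u"
proof -
  have "dist p (p + u) \<in> side_lengths \<T>"
    unfolding side_lengths_def using assms triangle_edge by blast
  then show ?thesis using \<delta> by (simp add: dist_norm)
qed

text \<open>A packing argument: every such tile contains a ball of the fixed radius
  \<open>\<delta> / 4\<close> centred near \<open>x\<close>, and these balls are disjoint for
  different tiles, so the centres form a bounded uniformly discrete set.\<close>

lemma finite_meeting_cball: "finite {T \<in> \<T>. T \<inter> cball x r \<noteq> {}}"
proof -
  let ?F = "{T \<in> \<T>. T \<inter> cball x r \<noteq> {}}"
  have "\<exists>g. g \<in> cball x (r + 2 * \<delta>) \<and> ball g (\<delta> / 4) \<subseteq> T" if "T \<in> ?F" for T
  proof -
    from that obtain y where "y \<in> T \<inter> cball x r" by blast
    then have y: "T \<in> \<T>" "y \<in> T" "dist x y \<le> r" using that by auto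
    obtain p u v where T: "equi_frame u v" "T = triangle p u v" using tile_frame[OF y(1)] .
    have u: "\<delta> \<le> norm u" using tile_size T y by blast
    then have "norm u > 0" using \<delta>_pos by linarith
    \<comment> \<open>This fraction makes the radius independent of the size of the tile, which has
      no upper bound.\<close>
    then have "0 < \<delta> / norm u" "\<delta> / norm u \<le> 1" using u \<delta>_pos by simp_all
    then obtain g where "ball g (\<delta> / norm u * norm u / 4) \<subseteq> T" "dist y g \<le> 2 * (\<delta> / norm u) * norm u"
      using triangle_centre_ball[OF T(1)] y(2) T(2) by blast
    moreover have "norm u \<noteq> 0" using u \<delta>_pos by linarith
    ultimately show ?thesis using y(3) dist_triangle[of x g y] by (intro exI[of _ g]) auto
  qed
  then have "\<forall>T\<in>?F. \<exists>g. g \<in> cball x (r + 2 * \<delta>) \<and> ball g (\<delta> / 4) \<subseteq> T" by blast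
  from bchoice[OF this] obtain g
    where gF: "\<forall>T\<in>?F. g T \<in> cball x (r + 2 * \<delta>) \<and> ball (g T) (\<delta> / 4) \<subseteq> T" ..
  have g: "g T \<in> cball x (r + 2 * \<delta>)" "ball (g T) (\<delta> / 4) \<subseteq> T" if "T \<in> ?F" for T
    using gF that by blast+
  have sep: "S = T" if "S \<in> ?F" "T \<in> ?F" "dist (g S) (g T) < \<delta> / 4" for S T
  proof (rule tile_eqI)
    have "g T \<in> ball (g S) (\<delta> / 4) \<inter> ball (g T) (\<delta> / 4)" using that(3) \<delta>_pos by simp
    then show "interior S \<inter> interior T \<noteq> {}"
      using interior_maximal[OF g(2)[OF that(1)] open_ball] interior_maximal[OF g(2)[OF that(2)] open_ball]
      by blast
  qed (use that in auto)
  have "inj_on g ?F"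
  proof (rule inj_onI)
    fix S T assume a: "S \<in> ?F" "T \<in> ?F" "g S = g T"
    show "S = T" by (rule sep[OF a(1,2)]) (use a(3) \<delta>_pos in simp)
  qed
  moreover have "finite (g ` ?F)"
  proof -
    have "uniform_discrete (g ` ?F)"
      unfolding uniform_discrete_def
    proof (intro exI[of _ "\<delta> / 4"] conjI ballI impI)
      fix a b assume "a \<in> g ` ?F" "b \<in> g ` ?F" and d: "dist a b < \<delta> / 4"
      then obtain S T where ST: "S \<in> ?F" "T \<in> ?F" and ab: "a = g S" "b = g T" by (elim imageE)
      show "a = b" using sep[OF ST] d unfolding ab by simp
    qed (use \<delta>_pos in simp)
    moreover have "bounded (g ` ?F)"
      by (rule bounded_subset[OF bounded_cball[of x "r + 2 * \<delta>"]]) (rule image_subsetI, rule g(1))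
    ultimately have "discrete (g ` ?F)" "compact (g ` ?F)"
      by (simp_all add: uniform_discrete_imp_discrete uniform_discrete_imp_closed compact_eq_bounded_closed)
    then show ?thesis using discrete_compact_finite_iff[of "g ` ?F"] by simp
  qed
  ultimately show ?thesis using finite_imageD by blast
qed

text \<open>Among the finitely many tiles near \<open>p\<close>, one contains infinitely many points
  of a sequence tending to \<open>p\<close> along the ray; being closed, it contains
  \<open>p\<close>.\<close>

lemma tile_in_direction:
  obtains A e where "A \<in> \<T>" "p \<in> A" "e > 0" "p + e *\<^sub>R w \<in> A"
proof (cases "w = 0")
  case True
  have "p \<in> \<Union>\<T>" using tiles by (simp add: tiles_def)
  then show thesis using that[of _ 1] True by auto
next
  case False
  define c where "c n = inverse (real (Suc n)) / norm w" for n
  have c: "c n > 0" for n using False by (simp add: c_def)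
  have "\<exists>T. T \<in> \<T> \<and> p + c n *\<^sub>R w \<in> T" for n using tiles by (auto simp: tiles_def)
  then obtain f where f: "\<And>n. f n \<in> \<T>" "\<And>n. p + c n *\<^sub>R w \<in> f n" by metis
  have "dist p (p + c n *\<^sub>R w) = inverse (real (Suc n))" for n
    using False by (simp add: c_def dist_norm)
  note d = this
  have "inverse (real (Suc n)) \<le> 1" for n by (simp add: inverse_le_1_iff)
  then have "range f \<subseteq> {T \<in> \<T>. T \<inter> cball p 1 \<noteq> {}}" using f d by fastforce
  then have "finite (range f)" using finite_meeting_cball finite_subset by blast
  then obtain n0 where n0: "infinite {n \<in> UNIV. f n = f n0}"
    using pigeonhole_infinite[of "UNIV :: nat set" f] by auto
  have "p \<in> closure (f n0)"
    unfolding closure_approachable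
  proof (intro allI impI)
    fix e :: real assume "e > 0"
    then obtain N where N: "inverse (real (Suc N)) < e" using reals_Archimedean by blast
    obtain n where n: "n > N" "f n = f n0" using n0 unfolding infinite_nat_iff_unbounded by auto
    have "inverse (real (Suc n)) \<le> inverse (real (Suc N))" using n(1) by simp
    then have "dist (p + c n *\<^sub>R w) p < e" using d[of n] N by (metis dist_commute le_less_trans)
    then show "\<exists>y\<in>f n0. dist y p < e"
      using f(2)[of n] n(2) by auto
  qed
  then have "p \<in> f n0" using tile_props(4)[OF f(1)] by simp
  then show thesis using that f c by blast
qed

definition corners where "corners = (\<Union>T\<in>\<T>. {x. x extreme_point_of T})"

lemma countable_corners: "countable corners"
proof -
  have "\<T> \<subseteq> (\<Union>n::nat. {T \<in> \<T>. T \<inter> cball 0 (real n) \<noteq> {}})"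
  proof
    fix T assume T: "T \<in> \<T>"
    then obtain y where "y \<in> T" using tile_props(3) interior_subset by blast
    moreover obtain n where "norm y \<le> real n" using real_arch_simple by blast
    ultimately have "y \<in> T \<inter> cball 0 (real n)" by simp
    then show "T \<in> (\<Union>n::nat. {T \<in> \<T>. T \<inter> cball 0 (real n) \<noteq> {}})" using T by blast
  qed
  moreover have "countable (\<Union>n::nat. {T \<in> \<T>. T \<inter> cball 0 (real n) \<noteq> {}})"
    using finite_meeting_cball by (intro countable_UN) (auto intro: countable_finite)
  ultimately have "countable \<T>" using countable_subset by blast
  moreover have "countable {x. x extreme_point_of T}" if T: "T \<in> \<T>" for T
  proof -
    obtain p u v where "equi_frame u v" "T = triangle p u v" using tile_frame[OF T] .
    then show ?thesis by (simp add: triangle_extreme countable_finite)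
  qed
  ultimately show ?thesis unfolding corners_def by auto
qed

lemma corner_in_corners: "triangle p u v \<in> \<T> \<Longrightarrow> equi_frame u v \<Longrightarrow> {p, p + u, p + v} \<subseteq> corners"
  unfolding corners_def using triangle_extreme by blast

text \<open>An induction principle over contacts. Since corners may be ignored, only contacts at
  inner points of sides have to be examined; it spreads first the orientation and later the
  mesh.\<close>

lemma all_tiles:
  assumes "\<S> \<subseteq> \<T>" "\<S> \<noteq> {}"
    and "\<And>A T z. A \<in> \<S> \<Longrightarrow> T \<in> \<T> \<Longrightarrow> z \<in> A \<Longrightarrow> z \<in> T \<Longrightarrow> z \<notin> corners \<Longrightarrow> T \<in> \<S>"
  shows "\<S> = \<T>"
  by (rule connected_off_countable[OF finite_meeting_cball _ _ _ countable_corners assms])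
    (use tile_props tiles in \<open>auto simp: tiles_def\<close>)

text \<open>Two sides crossing at inner points would leave a direction pointing strictly into both
  triangles, which would then overlap.\<close>

lemma contact_parallel:
  assumes A: "triangle p u v \<in> \<T>" "equi_frame u v" and T: "triangle p' u' v' \<in> \<T>" "equi_frame u' v'"
    and z: "z = p + a *\<^sub>R u" "0 < a" "a < 1" "z = p' + a' *\<^sub>R u'" "0 < a'" "a' < 1"
    and ne: "triangle p u v \<noteq> triangle p' u' v'"
  obtains x where "u' = x *\<^sub>R u"
proof -
  obtain x y where u': "u' = x *\<^sub>R u + y *\<^sub>R v" using equi_frame_span[OF A(2)] .
  obtain x' y' where u: "u = x' *\<^sub>R u' + y' *\<^sub>R v'" using equi_frame_span[OF T(2)] .
  have "y = 0 \<or> y' = 0"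
  proof (rule ccontr)
    assume y: "\<not> (y = 0 \<or> y' = 0)"
    \<comment> \<open>The first summand points to the inner side of \<open>u\<close>, the second to
      the inner side of \<open>u'\<close>, and each is parallel to the other side.\<close>
    define w where "w = sgn y *\<^sub>R u' + sgn y' *\<^sub>R u"
    have "germ (triangle p u v) (p + a *\<^sub>R u + 0 *\<^sub>R v) ((sgn y * x + sgn y') *\<^sub>R u + (sgn y * y) *\<^sub>R v)"
      using z y by (intro triangle_germ A) (auto simp: sgn_real_def)
    also have "(sgn y * x + sgn y') *\<^sub>R u + (sgn y * y) *\<^sub>R v = w"
      unfolding w_def u' by (simp add: algebra_simps)
    finally have 1: "germ (triangle p u v) z w" using z by simp
    have "germ (triangle p' u' v') (p' + a' *\<^sub>R u' + 0 *\<^sub>R v')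
        ((sgn y + sgn y' * x') *\<^sub>R u' + (sgn y' * y') *\<^sub>R v')"
      using z y by (intro triangle_germ T) (auto simp: sgn_real_def)
    also have "(sgn y + sgn y' * x') *\<^sub>R u' + (sgn y' * y') *\<^sub>R v' = sgn y *\<^sub>R u' + sgn y' *\<^sub>R (x' *\<^sub>R u' + y' *\<^sub>R v')"
      by (simp add: algebra_simps)
    also have "\<dots> = w" unfolding w_def u[symmetric] ..
    finally have "germ (triangle p' u' v') z w" using z by simp
    then show False using 1 tile_germ_eqI A T ne by blast
  qed
  then show thesis
  proof
    assume "y = 0" then show thesis using that[of x] u' by simp
  next
    assume y': "y' = 0"
    have ux: "u = x' *\<^sub>R u'" using u unfolding y' by (simp only: scaleR_zero_left add_0_right)
    have "x' \<noteq> 0"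
    proof
      assume "x' = 0" then have "u = 0" using ux by (simp only: scaleR_zero_left)
      then show False using A(2) by (simp add: equi_frame_def)
    qed
    then have "u' = (1 / x') *\<^sub>R u" unfolding ux by simp
    then show thesis by (rule that)
  qed
qed

end

section \<open>Tilings as corner systems\<close>

definition hexdir :: "real^2 \<Rightarrow> real^2 \<Rightarrow> int \<Rightarrow> real^2" where
  "hexdir u v k = (let r = k mod 6 in if r = 0 then u else if r = 1 then v else if r = 2 then v - u
     else if r = 3 then - u else if r = 4 then - v else u - v)"

lemma hexdir_add_2: "hexdir u v (k + 2) = hexdir u v (k + 1) - hexdir u v k"
proof -
  define r where "r = k mod 6"
  have m: "(k + 1) mod 6 = (r + 1) mod 6" "(k + 2) mod 6 = (r + 2) mod 6"
    by (simp_all add: r_def mod_simps)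
  have "r \<in> {0, 1, 2, 3, 4, 5}" using pos_mod_bound[of 6 k] pos_mod_sign[of 6 k] unfolding r_def by auto
  then show ?thesis unfolding hexdir_def m by (auto simp flip: r_def)
qed

lemma triangle_translate: "(+) w ` triangle p u v = triangle (p + w) u v"
proof -
  have "(+) w ` triangle p u v = convex hull ((+) w ` {p, p + u, p + v})"
    unfolding triangle_def by (rule convex_hull_translation[symmetric])
  then show ?thesis by (simp add: triangle_def algebra_simps)
qed

text \<open>One tile supplies the directions and the unit of length, so sizes are multiples of
  \<open>norm e\<close>. Its frame may have either orientation; counterclockwise is understood
  relative to it.\<close>

locale oriented_tiling = equilateral_tiling +
  fixes e f :: "real^2"
  assumes base: "equi_frame e f" and base_tile: "\<exists>p. triangle p e f \<in> \<T>"
begin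

section \<open>Triangles with sides in the six directions\<close>

definition "D = hexdir e f"
definition "tri p k s = triangle p (s *\<^sub>R D k) (s *\<^sub>R D (k + 1))"
definition "C p k s \<longleftrightarrow> 0 < s \<and> tri p k s \<in> \<T>"

sublocale hex_directions D
  by unfold_locales (simp add: D_def hexdir_add_2)

lemma equi_frame_D: "equi_frame (D k) (D (k + 1))"
proof (induction k rule: int_induct[where k = 0])
  case base
  then show ?case using oriented_tiling_axioms by (simp add: D_def hexdir_def oriented_tiling_def oriented_tiling_axioms_def)
next
  case (step1 i)
  have "D (i + 1 + 1) = D (i + 1) - D i" using D_add_2[of i] by (simp add: int_num_commute)
  moreover have "equi_frame v (v - u)" if "equi_frame u v" for u v
    using that by (auto simp: equi_frame_def norm_minus_commute)
  ultimately show ?case using step1 by simp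
next
  case (step2 i)
  have "D (i - 1) = D i - D (i + 1)" using D_add_2[of "i - 1"] by (simp add: algebra_simps)
  moreover have "equi_frame (u - v) u" if "equi_frame u v" for u v
    using that by (auto simp: equi_frame_def norm_minus_commute)
  ultimately show ?case using step2 by simp
qed

lemma norm_D: "norm (D k) = norm e"
proof -
  have 1: "norm (D (k + 1)) = norm (D k)" for k using equi_frame_D[of k] by (simp add: equi_frame_def)
  have "norm (D k) = norm (D 0)"
  proof (induction k rule: int_induct[where k = 0])
    case (step2 i)
    then show ?case using 1[of "i - 1"] by simp
  qed (simp_all add: 1)
  then show ?thesis by (simp add: D_def hexdir_def)
qed

lemma norm_e: "norm e > 0" using base by (simp add: equi_frame_def)

lemma D_nonzero: "D k \<noteq> 0" using equi_frame_D[of k] by (simp add: equi_frame_def)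

lemmas D_unique = equi_frame_unique[OF equi_frame_D]

lemma tri_frame: "0 < s \<Longrightarrow> equi_frame (s *\<^sub>R D k) (s *\<^sub>R D (k + 1))"
  using equi_frame_scale[OF equi_frame_D, of s k] by simp

lemma tri_mod: "k mod 6 = k' mod 6 \<Longrightarrow> tri p k s = tri p k' s"
  using D_mod[of k k'] D_mod[of "k + 1" "k' + 1"] by (simp add: tri_def mod_add_cong)

lemma tri_rotate: "tri (p + s *\<^sub>R D k) (k + 2) s = tri p k s"
  unfolding tri_def triangle_rotate[of p] by (simp add: D_simps algebra_simps)

lemma tri_mem:
  assumes "0 < s"
  shows "z \<in> tri p k s \<longleftrightarrow> (\<exists>a b. 0 \<le> a \<and> 0 \<le> b \<and> a + b \<le> s \<and> z = p + a *\<^sub>R D k + b *\<^sub>R D (k + 1))"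
proof
  assume "z \<in> tri p k s"
  then obtain a b where "z = p + (a * s) *\<^sub>R D k + (b * s) *\<^sub>R D (k + 1)" "0 \<le> a" "0 \<le> b" "a + b \<le> 1"
    unfolding tri_def triangle_eq by auto
  moreover have "a * s + b * s \<le> 1 * s"
    using calculation assms by (simp only: distrib_right[symmetric]) (intro mult_right_mono, auto)
  ultimately show "\<exists>a b. 0 \<le> a \<and> 0 \<le> b \<and> a + b \<le> s \<and> z = p + a *\<^sub>R D k + b *\<^sub>R D (k + 1)"
    using assms by (intro exI[of _ "a * s"] exI[of _ "b * s"]) auto
next
  assume "\<exists>a b. 0 \<le> a \<and> 0 \<le> b \<and> a + b \<le> s \<and> z = p + a *\<^sub>R D k + b *\<^sub>R D (k + 1)"
  then obtain a b where "0 \<le> a" "0 \<le> b" "a + b \<le> s" "z = p + a *\<^sub>R D k + b *\<^sub>R D (k + 1)" by blast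
  then show "z \<in> tri p k s" unfolding tri_def triangle_eq using assms
    by (simp, intro exI[of _ "a / s"] exI[of _ "b / s"]) (auto simp: field_simps)
qed

lemma tri_coords:
  assumes "0 < s" "p + a *\<^sub>R D k + b *\<^sub>R D (k + 1) \<in> tri p k s"
  shows "0 \<le> a" "0 \<le> b" "a + b \<le> s"
  using assms D_unique[of a k b] unfolding tri_mem[OF assms(1)] by (force simp: add.assoc)+

lemma tri_germ:
  assumes s: "0 < s" and ab: "0 \<le> a" "0 \<le> b" "a + b \<le> s"
    and w: "a = 0 \<Longrightarrow> \<alpha> > 0" "b = 0 \<Longrightarrow> \<beta> > 0" "a + b = s \<Longrightarrow> \<alpha> + \<beta> < 0"
  shows "germ (tri p k s) (p + a *\<^sub>R D k + b *\<^sub>R D (k + 1)) (\<alpha> *\<^sub>R D k + \<beta> *\<^sub>R D (k + 1))"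
proof -
  have "germ (tri p k s) (p + (a / s) *\<^sub>R (s *\<^sub>R D k) + (b / s) *\<^sub>R (s *\<^sub>R D (k + 1)))
      ((\<alpha> / s) *\<^sub>R (s *\<^sub>R D k) + (\<beta> / s) *\<^sub>R (s *\<^sub>R D (k + 1)))"
    unfolding tri_def using s ab w
    by (intro triangle_germ tri_frame) (auto simp: divide_simps zero_less_divide_iff divide_less_0_iff
        simp flip: add_divide_distrib)
  then show ?thesis using s by simp
qed

lemma tri_corner: "0 < s \<Longrightarrow> p \<in> tri p k s"
  unfolding tri_mem by (intro exI[of _ 0]) simp

lemma tri_side: "0 \<le> t \<Longrightarrow> t \<le> s \<Longrightarrow> 0 < s \<Longrightarrow> p + t *\<^sub>R D k \<in> tri p k s"
  unfolding tri_mem by (intro exI[of _ t] exI[of _ 0]) simp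

text \<open>Each apex lies in the cone of the other triangle. The cone spanned by \<open>D k\<close>
  and \<open>D (k + 1)\<close> is pointed, so the apexes coincide.\<close>

lemma tri_inj:
  assumes s: "0 < s" "0 < s'" and eq: "tri p k s = tri q k s'"
  shows "p = q" "s = s'"
proof -
  have "p \<in> tri q k s'" "q \<in> tri p k s"
    using tri_corner[OF s(1), of p k] tri_corner[OF s(2), of q k] unfolding eq by simp_all
  then obtain a b a' b' where ab: "0 \<le> a" "0 \<le> b" "p = q + a *\<^sub>R D k + b *\<^sub>R D (k + 1)"
    "0 \<le> a'" "0 \<le> b'" "q = p + a' *\<^sub>R D k + b' *\<^sub>R D (k + 1)"
    unfolding tri_mem[OF s(1)] tri_mem[OF s(2)] by blast
  have d: "p - q = a *\<^sub>R D k + b *\<^sub>R D (k + 1)" by (subst ab(3)) simp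
  have d': "q - p = a' *\<^sub>R D k + b' *\<^sub>R D (k + 1)" by (subst ab(6)) simp
  have "(a + a') *\<^sub>R D k + (b + b') *\<^sub>R D (k + 1) = (p - q) + (q - p)"
    unfolding d d' by (simp add: algebra_simps)
  then have "(a + a') *\<^sub>R D k + (b + b') *\<^sub>R D (k + 1) = 0" by simp
  then have "a + a' = 0" "b + b' = 0" using equi_frame_zero[OF equi_frame_D] by blast+
  then have "a = 0" "b = 0" using ab(1,2,4,5) by linarith+
  then show pq: "p = q" using d by simp
  have "p + s *\<^sub>R D k + 0 *\<^sub>R D (k + 1) \<in> tri p k s'" "p + s' *\<^sub>R D k + 0 *\<^sub>R D (k + 1) \<in> tri p k s"
    using tri_side[of s s p k] tri_side[of s' s' p k] s eq pq by simp_all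
  then have "s \<le> s'" "s' \<le> s" using tri_coords(3)[OF s(2)] tri_coords(3)[OF s(1)] by fastforce+
  then show "s = s'" by simp
qed

text \<open>This distinguishes a corner from interior points and from inner points of sides, which
  are midpoints of segments in the triangle.\<close>

lemma tri_pointed:
  assumes s: "0 < s" and "p + w \<in> tri p k s" "p - w \<in> tri p k s"
  shows "w = 0"
proof -
  obtain a b where w: "w = a *\<^sub>R D k + b *\<^sub>R D (k + 1)" using equi_frame_span[OF equi_frame_D] .
  have "p + w = p + a *\<^sub>R D k + b *\<^sub>R D (k + 1)"
    "p - w = p + (- a) *\<^sub>R D k + (- b) *\<^sub>R D (k + 1)" by (simp_all add: w)
  note * = assms(2,3)[unfolded this]
  have "a = 0" "b = 0" using tri_coords(1,2)[OF s *(1)] tri_coords(1,2)[OF s *(2)] by simp_all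
  then show ?thesis by (simp add: w)
qed

lemma tri_corner_not_interior:
  assumes "0 < s"
  shows "p \<notin> interior (tri p k s)"
proof
  assume "p \<in> interior (tri p k s)"
  then obtain d where d: "d > 0" "ball p d \<subseteq> tri p k s" unfolding mem_interior by blast
  define w where "w = (d / 2 / norm e) *\<^sub>R D k"
  have "norm w = d / 2" using d norm_e by (simp add: w_def norm_D)
  then have "p + w \<in> tri p k s" "p - w \<in> tri p k s" using d by (auto simp: dist_norm intro!: subsetD[OF d(2)])
  then have "w = 0" using tri_pointed[OF assms] by blast
  then show False using \<open>norm w = d / 2\<close> d by simp
qed

lemma tri_boundary_cases:
  assumes s: "0 < s" and z: "z \<in> tri p k s"
  obtains "z \<in> interior (tri p k s)"
  | q j where "tri q j s = tri p k s" "(q, j) \<in> {(p, k), (p + s *\<^sub>R D k, k + 2), (p + s *\<^sub>R D (k + 1), k + 4)}" "z = q"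
  | q j t where "tri q j s = tri p k s" "(q, j) \<in> {(p, k), (p + s *\<^sub>R D k, k + 2), (p + s *\<^sub>R D (k + 1), k + 4)}"
      "z = q + t *\<^sub>R D j" "0 < t" "t < s"
proof -
  obtain a b where ab: "z = p + a *\<^sub>R D k + b *\<^sub>R D (k + 1)" "0 \<le> a" "0 \<le> b" "a + b \<le> s"
    using z unfolding tri_mem[OF s] by blast
  have r: "tri (p + s *\<^sub>R D k) (k + 2) s = tri p k s" "tri (p + s *\<^sub>R D (k + 1)) (k + 4) s = tri p k s"
    using tri_rotate[of p s k] tri_rotate[of "p + s *\<^sub>R D k" s "k + 2"] by (auto simp: D_simps algebra_simps)
  consider "a > 0" "b > 0" "a + b < s" | "a = 0" "b = 0" | "a = s" "b = 0" | "a = 0" "b = s"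
    | "b = 0" "0 < a" "a < s" | "a + b = s" "0 < b" "b < s" | "a = 0" "0 < s - b" "s - b < s"
    using ab by argo
  then show thesis
  proof cases
    case 1
    have "p + (a / s) *\<^sub>R (s *\<^sub>R D k) + (b / s) *\<^sub>R (s *\<^sub>R D (k + 1)) \<in> interior (tri p k s)"
      unfolding tri_def using 1 s by (intro triangle_interior tri_frame) (auto simp: field_simps)
    then show thesis using that(1) ab s by simp
  next
    case 2
    then show thesis using ab(1) by (intro that(2)[of p k]) auto
  next
    case 3
    then show thesis using ab(1) r by (intro that(2)[of "p + s *\<^sub>R D k" "k + 2"]) auto
  next
    case 4
    then show thesis using ab(1) r by (intro that(2)[of "p + s *\<^sub>R D (k + 1)" "k + 4"]) auto
  next
    case 5
    then show thesis using ab(1) by (intro that(3)[of p k a]) auto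
  next
    case 6
    then have a: "a = s - b" by simp
    have "z = p + s *\<^sub>R D k + b *\<^sub>R D (k + 2)" unfolding ab(1) a by (simp add: D_simps algebra_simps)
    then show thesis using 6 r by (intro that(3)[of "p + s *\<^sub>R D k" "k + 2" b]) auto
  next
    case 7
    have "z = p + s *\<^sub>R D (k + 1) + (s - b) *\<^sub>R D (k + 4)"
      unfolding ab(1) 7(1) by (simp add: D_simps algebra_simps)
    then show thesis using 7 r by (intro that(3)[of "p + s *\<^sub>R D (k + 1)" "k + 4" "s - b"]) auto
  qed
qed

lemma tri_in_corners: "C p k s \<Longrightarrow> p \<in> corners"
  using corner_in_corners[of p "s *\<^sub>R D k" "s *\<^sub>R D (k + 1)"] tri_frame[of s k]
  by (simp add: C_def tri_def)

lemma triangle_parallel_tri: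
  assumes uv: "equi_frame u v" and u: "u = x *\<^sub>R D j" and v: "v = x *\<^sub>R D (j + 1) \<or> v = x *\<^sub>R D (j + 5)"
  obtains k s where "0 < s" "triangle p u v = tri p k s"
proof -
  have "x \<noteq> 0" using uv u by (auto simp: equi_frame_def)
  then consider "x > 0" "v = x *\<^sub>R D (j + 1)" | "x > 0" "v = x *\<^sub>R D (j + 5)"
    | "x < 0" "v = x *\<^sub>R D (j + 1)" | "x < 0" "v = x *\<^sub>R D (j + 5)" using v by linarith
  then show thesis
  proof cases
    case 1
    then show thesis using that[of x j] u by (simp add: tri_def)
  next
    case 2
    then show thesis using that[of x "j + 5"] u triangle_swap[of p u v]
      by (simp add: tri_def D_simps int_num_commute)
  next
    case 3
    then show thesis using that[of "- x" "j + 3"] u by (simp add: tri_def D_simps int_num_commute)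
  next
    case 4
    then show thesis using that[of "- x" "j + 2"] u triangle_swap[of p u v]
      by (simp add: tri_def D_simps scaleR_diff_right int_num_commute)
  qed
qed

text \<open>Orientation spreads through contacts at inner points of sides:
  \<open>contact_parallel\<close> aligns the sides, and \<open>side_contact_frame\<close> leaves two
  positions of the third vertex, both along the six directions.\<close>

lemma tile_oriented:
  assumes "T \<in> \<T>"
  obtains p k s where "C p k s" "T = tri p k s"
proof -
  define \<S> where "\<S> = {T \<in> \<T>. \<exists>p k s. 0 < s \<and> T = tri p k s}"
  have "\<S> = \<T>"
  proof (rule all_tiles)
    show "\<S> \<subseteq> \<T>" by (auto simp: \<S>_def)
    obtain p where "triangle p e f \<in> \<T>" using base_tile by blast
    moreover have "triangle p e f = tri p 0 1" by (simp add: tri_def D_def hexdir_def)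
    ultimately have "triangle p e f \<in> \<S>" unfolding \<S>_def using zero_less_one by blast
    then show "\<S> \<noteq> {}" by blast
    fix A T z assume A: "A \<in> \<S>" and T: "T \<in> \<T>" and z: "z \<in> A" "z \<in> T" "z \<notin> corners"
    show "T \<in> \<S>"
    proof (cases "T = A")
      case True then show ?thesis using A by simp
    next
      case False
      obtain p k s where s: "0 < s" "A = tri p k s" and AT: "A \<in> \<T>" using A by (auto simp: \<S>_def)
      have nA: "z \<notin> interior A" "z \<notin> interior T" using tile_interior_eqI AT T z False by blast+
      obtain q j t where q: "A = tri q j s" "z = q + t *\<^sub>R D j" "0 < t" "t < s"
      proof (rule tri_boundary_cases[OF s(1) z(1)[unfolded s(2)]])
        fix q j assume "tri q j s = tri p k s" "z = q"
        then show thesis using tri_in_corners[of q j s] AT s z by (auto simp: C_def)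
      qed (use nA s that in auto)
      obtain p' u' v' where T': "equi_frame u' v'" "T = triangle p' u' v'" using tile_frame[OF T] .
      obtain p'' u v a where a: "T = triangle p'' u v" "equi_frame u v" "z = p'' + a *\<^sub>R u" "0 < a" "a < 1"
      proof (rule triangle_boundary_cases[OF T'(1) z(2)[unfolded T'(2)]])
        assume "z \<in> {p', p' + u', p' + v'}"
        then show thesis using corner_in_corners[of p' u' v'] T T' z by auto
      next
        fix p'' u v a
        assume "triangle p'' u v = triangle p' u' v'" "equi_frame u v" "z = p'' + a *\<^sub>R u" "0 < a" "a < 1"
        then show thesis using that[of p'' u v a] T'(2) by blast
      qed (use nA T' in auto)
      have zt: "z = q + (t / s) *\<^sub>R (s *\<^sub>R D j)" using s q by simp
      obtain x where u: "u = x *\<^sub>R (s *\<^sub>R D j)"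
        by (rule contact_parallel[OF _ tri_frame[OF s(1)] _ a(2) zt _ _ a(3-5)])
          (use AT T q a s False in \<open>auto simp flip: tri_def\<close>)
      have "v = x *\<^sub>R (s *\<^sub>R D (j + 1)) \<or> v = x *\<^sub>R (s *\<^sub>R D j - s *\<^sub>R D (j + 1))"
        using side_contact_frame[OF tri_frame[OF s(1)] a(2) u] .
      then have v: "v = (x * s) *\<^sub>R D (j + 1) \<or> v = (x * s) *\<^sub>R D (j + 5)"
        by (auto simp: D_simps algebra_simps)
      have "u = (x * s) *\<^sub>R D j" using u by simp
      from triangle_parallel_tri[OF a(2) this v, of p'']
      obtain k' s' where "0 < s'" "triangle p'' u v = tri p'' k' s'" by blast
      then show ?thesis using T a(1) by (auto simp: \<S>_def)
    qed
  qed
  then have "T \<in> \<S>" using assms by simp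
  then obtain p k s where "0 < s" "T = tri p k s" by (auto simp: \<S>_def)
  then show thesis using that assms by (simp add: C_def)
qed

section \<open>The axioms of the corner system\<close>

lemma tri_germ_corner:
  assumes "0 < s"
  shows "germ (tri p k s) p (D k + D (k + 1))"
  using tri_germ[of s 0 0 1 1 p k] assms by simp

text \<open>The vector \<open>D j + D (j + 1)\<close> bisects sector \<open>j\<close> and serves as
  its test direction. A tile with a side through \<open>p\<close> owns the three sectors on its side
  of the line.\<close>

lemma tri_germ_side:
  assumes "0 < t" "t < s" "i \<in> {0, 1, 2}"
  shows "germ (tri (p - t *\<^sub>R D m) m s) p (D (m + i) + D (m + i + 1))"
proof -
  have g: "germ (tri (p - t *\<^sub>R D m) m s) p (\<alpha> *\<^sub>R D m + \<beta> *\<^sub>R D (m + 1))" if "\<beta> > 0" for \<alpha> \<beta>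
    using tri_germ[of s t 0 \<alpha> \<beta> "p - t *\<^sub>R D m" m] assms that by simp
  consider "i = 0" | "i = 1" | "i = 2" using assms(3) by auto
  then show ?thesis
  proof cases
    case 1
    then show ?thesis using g[of 1 1] by simp
  next
    case 2
    have "D (m + i) + D (m + i + 1) = (- 1) *\<^sub>R D m + 2 *\<^sub>R D (m + 1)"
      using 2 by (simp add: D_simps int_num_commute scaleR_2)
    then show ?thesis using g[of 2 "- 1"] by simp
  next
    case 3
    have "D (m + i) + D (m + i + 1) = (- 2) *\<^sub>R D m + 1 *\<^sub>R D (m + 1)"
      using 3 by (simp add: D_simps int_num_commute scaleR_2)
    then show ?thesis using g[of 1 "- 2"] by simp
  qed
qed

text \<open>The point has coordinate \<open>- t'\<close> along \<open>D (m + 1)\<close>, so it lies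
  strictly across the line of the side.\<close>

lemma tri_not_before_side:
  assumes "0 < t" "t < s" "0 < t'" "i \<in> {1, 2}"
  shows "p - t' *\<^sub>R D (m + i) \<notin> tri (p - t *\<^sub>R D m) m s"
proof
  assume a: "p - t' *\<^sub>R D (m + i) \<in> tri (p - t *\<^sub>R D m) m s"
  have "i = 1 \<or> i = 2" using assms(4) by auto
  then have "\<exists>a. p - t' *\<^sub>R D (m + i) = p - t *\<^sub>R D m + a *\<^sub>R D m + (- t') *\<^sub>R D (m + 1)"
  proof
    assume "i = 1" then show ?thesis by (intro exI[of _ t]) simp
  next
    assume "i = 2" then show ?thesis by (intro exI[of _ "t + t'"]) (simp add: D_simps algebra_simps)
  qed
  then obtain b where "p - t' *\<^sub>R D (m + i) = p - t *\<^sub>R D m + b *\<^sub>R D m + (- t') *\<^sub>R D (m + 1)" ..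
  with a have "p - t *\<^sub>R D m + b *\<^sub>R D m + (- t') *\<^sub>R D (m + 1) \<in> tri (p - t *\<^sub>R D m) m s"
    by (simp only:)
  then show False using tri_coords(2)[of s] assms by fastforce
qed

text \<open>Some tile contains \<open>p\<close> and a further point on the bisector of sector
  \<open>k + 2\<close>. As \<open>p\<close> is a corner of some tile, it is not interior to this
  one, so it is a corner of it or lies on a side.\<close>

lemma C_cover:
  assumes "C p j s"
  shows "(\<exists>s. C p (k + 2) s) \<or> (\<exists>t s. side_at D C p (k + 2) t s) \<or>
      (\<exists>t s. side_at D C p (k + 1) t s) \<or> (\<exists>t s. side_at D C p k t s)"
proof -
  define w where "w = D (k + 2) + D (k + 3)"
  obtain A \<epsilon> where A: "A \<in> \<T>" "p \<in> A" "\<epsilon> > 0" "p + \<epsilon> *\<^sub>R w \<in> A" using tile_in_direction .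
  obtain q i \<sigma> where t: "C q i \<sigma>" "A = tri q i \<sigma>" using tile_oriented[OF A(1)] .
  have \<sigma>: "0 < \<sigma>" using t by (simp add: C_def)
  \<comment> \<open>Here \<open>e\<close> counts the sectors from \<open>i'\<close> to the bisected
    one. A corner needs both coordinates nonnegative, which leaves \<open>e = 0\<close>; a side
    needs only the second, which leaves \<open>e\<close> up to 2.\<close>
  have coords: "\<exists>e \<alpha> \<beta>. (k + 2) mod 6 = (i' + e) mod 6 \<and> w = \<alpha> *\<^sub>R D i' + \<beta> *\<^sub>R D (i' + 1) \<and>
      (e = 0 \<or> e = 1 \<and> \<alpha> < 0 \<or> e = 2 \<and> \<alpha> < 0 \<or> \<beta> < 0)" for i'
  proof -
    define e where "e = (k + 2 - i') mod 6"
    have m: "(k + 2) mod 6 = (i' + e) mod 6" by (simp add: e_def mod_simps)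
    then have "(k + 2 + 1) mod 6 = (i' + e + 1) mod 6" by (metis mod_add_left_eq)
    then have w: "w = D (i' + e) + D (i' + e + 1)"
      unfolding w_def using D_mod[OF m] D_mod[of "k + 3" "i' + e + 1"] by (simp add: int_num_commute)
    have "e \<in> {0, 1, 2, 3, 4, 5}"
      using pos_mod_bound[of 6 "k + 2 - i'"] pos_mod_sign[of 6 "k + 2 - i'"] unfolding e_def by auto
    then consider "e = 0" | "e = 1" | "e = 2" | "e = 3" | "e = 4" | "e = 5" by auto
    then show ?thesis
    proof cases
      case 1 with m w show ?thesis by (intro exI[of _ e] exI[of _ 1] exI[of _ 1]) simp
    next
      case 2 with m w show ?thesis by (intro exI[of _ e] exI[of _ "- 1"] exI[of _ 2])
        (simp add: D_simps int_num_commute scaleR_2)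
    next
      case 3 with m w show ?thesis by (intro exI[of _ e] exI[of _ "- 2"] exI[of _ 1])
        (simp add: D_simps int_num_commute scaleR_2)
    next
      case 4 with m w show ?thesis by (intro exI[of _ e] exI[of _ "- 1"] exI[of _ "- 1"])
        (simp add: D_simps int_num_commute scaleR_2)
    next
      case 5 with m w show ?thesis by (intro exI[of _ e] exI[of _ 1] exI[of _ "- 2"])
        (simp add: D_simps int_num_commute scaleR_2)
    next
      case 6 with m w show ?thesis by (intro exI[of _ e] exI[of _ 2] exI[of _ "- 1"])
        (simp add: D_simps int_num_commute scaleR_2)
    qed
  qed
  show ?thesis
  proof (rule tri_boundary_cases[OF \<sigma> A(2)[unfolded t(2)]])
    assume "p \<in> interior (tri q i \<sigma>)"
    moreover have "0 < s" "tri p j s \<in> \<T>" using assms by (auto simp: C_def)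
    ultimately have "p \<in> interior (tri p j s)"
      using tile_interior_eqI[of "tri q i \<sigma>" "tri p j s" p] A(1) t(2) tri_corner by auto
    then show ?thesis using tri_corner_not_interior \<open>0 < s\<close> by blast
  next
    fix q' i' assume q': "tri q' i' \<sigma> = tri q i \<sigma>" "p = q'"
    obtain e \<alpha> \<beta> where e: "(k + 2) mod 6 = (i' + e) mod 6" "w = \<alpha> *\<^sub>R D i' + \<beta> *\<^sub>R D (i' + 1)"
      "e = 0 \<or> e = 1 \<and> \<alpha> < 0 \<or> e = 2 \<and> \<alpha> < 0 \<or> \<beta> < 0" using coords by blast
    have "p + (\<epsilon> * \<alpha>) *\<^sub>R D i' + (\<epsilon> * \<beta>) *\<^sub>R D (i' + 1) \<in> tri p i' \<sigma>"
      using A(4) q' t(2) e(2) by (simp add: algebra_simps)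
    from tri_coords(1,2)[OF \<sigma> this] have "e = 0" using e(3) A(3) by (auto simp: zero_le_mult_iff)
    then have "C p (k + 2) \<sigma>" using e(1) q' A(1) t(2) \<sigma> tri_mod[of "k + 2" i'] by (simp add: C_def)
    then show ?thesis by blast
  next
    fix q' i' t' assume q': "tri q' i' \<sigma> = tri q i \<sigma>" "p = q' + t' *\<^sub>R D i'" "0 < t'" "t' < \<sigma>"
    obtain e \<alpha> \<beta> where e: "(k + 2) mod 6 = (i' + e) mod 6" "w = \<alpha> *\<^sub>R D i' + \<beta> *\<^sub>R D (i' + 1)"
      "e = 0 \<or> e = 1 \<and> \<alpha> < 0 \<or> e = 2 \<and> \<alpha> < 0 \<or> \<beta> < 0" using coords by blast
    have "q' + (t' + \<epsilon> * \<alpha>) *\<^sub>R D i' + (\<epsilon> * \<beta>) *\<^sub>R D (i' + 1) \<in> tri q' i' \<sigma>"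
      using A(4) q' t(2) e(2) by (simp add: algebra_simps)
    from tri_coords(2)[OF \<sigma> this] have "e = 0 \<or> e = 1 \<or> e = 2"
      using e(3) A(3) by (auto simp: zero_le_mult_iff)
    moreover have "side_at D C p m t' \<sigma>" if "i' mod 6 = m mod 6" for m
      using q' A(1) t(2) \<sigma> tri_mod[OF that] D_mod[OF that] by (simp add: C_def side_at_def)
    moreover have "i' mod 6 = (k + 2 - e) mod 6" using e(1) by (metis add_diff_cancel_right' mod_diff_left_eq)
    ultimately have "side_at D C p (k + 2) t' \<sigma> \<or> side_at D C p (k + 1) t' \<sigma> \<or> side_at D C p k t' \<sigma>"
      by (elim disjE) (auto simp: int_num_commute add.commute[of 1 k])
    then show ?thesis by blast
  qed
qed

sublocale hex_tiling D C "\<delta> / norm e"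
proof
  show "\<delta> / norm e > 0" using \<delta>_pos norm_e by simp
next
  fix p k s assume "C p k s"
  then have "\<delta> \<le> norm (s *\<^sub>R D k)" "0 < s"
    using tile_size[of p "s *\<^sub>R D k" "s *\<^sub>R D (k + 1)"] tri_frame[of s k] by (simp_all add: C_def tri_def)
  then show "\<delta> / norm e \<le> s" using norm_e by (simp add: norm_D divide_le_eq)
next
  fix p k s show "C p (k + 6) s \<longleftrightarrow> C p k s" using tri_mod[of "k + 6" k p s] by (simp add: C_def)
next
  fix p k s assume "C p k s" then show "C (p + s *\<^sub>R D k) (k + 2) s" by (simp add: C_def tri_rotate)
next
  fix p k s s' assume c: "C p k s" "C p (k + 1) s'"
  show "s \<noteq> s'"
  proof
    assume "s = s'"
    then have [simp]: "s' = s" ..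
    have s: "0 < s" using c by (simp add: C_def)
    have "closed_segment p (p + s *\<^sub>R D (k + 1)) edge_of tri p (k + 1) s"
      unfolding tri_def by (rule triangle_edge[OF tri_frame[OF s]])
    moreover have "closed_segment p (p + s *\<^sub>R D (k + 1)) edge_of tri p k s"
      unfolding tri_def triangle_swap[of p "s *\<^sub>R D k"] by (rule triangle_edge[OF equi_frame_swap[OF tri_frame[OF s]]])
    ultimately have "tri p k s = tri p (k + 1) s"
      using no_shared_side[of "tri p k s" "tri p (k + 1) s"] c by (auto simp: C_def share_side_def)
    then have "p + s *\<^sub>R D k \<in> tri p (k + 1) s" using tri_side[of s s p k] s by simp
    moreover have "p + s *\<^sub>R D k = p + s *\<^sub>R D (k + 1) + (- s) *\<^sub>R D (k + 1 + 1)"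
      by (simp add: D_simps int_num_commute algebra_simps)
    ultimately have "p + s *\<^sub>R D (k + 1) + (- s) *\<^sub>R D (k + 1 + 1) \<in> tri p (k + 1) s" by metis
    from tri_coords(2)[OF s this] show False using s by simp
  qed
next
  fix p j s k assume "C p j s"
  then show "(\<exists>s. C p (k + 2) s) \<or> (\<exists>t s. side_at D C p (k + 2) t s) \<or>
      (\<exists>t s. side_at D C p (k + 1) t s) \<or> (\<exists>t s. side_at D C p k t s)" by (rule C_cover)
next
  fix p k s s' assume c: "C p k s" "C p k s'"
  have "tri p k s = tri p k s'"
    by (rule tile_germ_eqI[of _ _ p "D k + D (k + 1)"]) (use c in \<open>auto simp: C_def intro: tri_germ_corner\<close>)
  then show "s = s'" using tri_inj(2) c by (auto simp: C_def)
next
  fix p m t s s' i assume S: "side_at D C p m t s" and i: "i \<in> {0, 1, 2::int}"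
  show "\<not> C p (m + i) s'"
  proof
    assume c: "C p (m + i) s'"
    have t: "0 < t" "t < s" "0 < s" "tri (p - t *\<^sub>R D m) m s \<in> \<T>" and s': "0 < s'" "tri p (m + i) s' \<in> \<T>"
      using S c by (auto simp: side_at_def C_def)
    have eq: "tri (p - t *\<^sub>R D m) m s = tri p (m + i) s'"
      by (rule tile_germ_eqI[OF t(4) s'(2) tri_germ_side[OF t(1,2) i] tri_germ_corner[OF s'(1)]])
    \<comment> \<open>Half the length of a segment along the side centred at \<open>p\<close>, as is
      impossible at a corner.\<close>
    define \<tau> where "\<tau> = min t (s - t)"
    have \<tau>: "0 < \<tau>" "\<tau> \<le> t" "t + \<tau> \<le> s" using t by (auto simp: \<tau>_def)
    have "p + \<tau> *\<^sub>R D m \<in> tri p (m + i) s'" "p - \<tau> *\<^sub>R D m \<in> tri p (m + i) s'"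
      unfolding eq[symmetric]
      using tri_side[of "t + \<tau>" s "p - t *\<^sub>R D m" m] tri_side[of "t - \<tau>" s "p - t *\<^sub>R D m" m] \<tau> t
      by (simp_all add: algebra_simps)
    then have "\<tau> *\<^sub>R D m = 0" by (rule tri_pointed[OF s'(1)])
    then show False using \<tau> D_nonzero by simp
  qed
next
  fix p m t s t' s' assume S: "side_at D C p m t s" "side_at D C p m t' s'"
  have t: "0 < t" "t < s" "0 < s" "tri (p - t *\<^sub>R D m) m s \<in> \<T>"
    "0 < t'" "t' < s'" "0 < s'" "tri (p - t' *\<^sub>R D m) m s' \<in> \<T>"
    using S by (auto simp: side_at_def C_def)
  have "tri (p - t *\<^sub>R D m) m s = tri (p - t' *\<^sub>R D m) m s'"
    by (rule tile_germ_eqI[OF t(4,8) tri_germ_side[of t s 0] tri_germ_side[of t' s' 0]]) (use t in auto)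
  from tri_inj[OF t(3,7) this] show "t = t' \<and> s = s'" using D_nonzero by simp
next
  fix p m t s t' s' i assume S: "side_at D C p m t s" and i: "i \<in> {1, 2::int}"
  show "\<not> side_at D C p (m + i) t' s'"
  proof
    assume S': "side_at D C p (m + i) t' s'"
    have t: "0 < t" "t < s" "0 < s" "tri (p - t *\<^sub>R D m) m s \<in> \<T>"
      "0 < t'" "t' < s'" "0 < s'" "tri (p - t' *\<^sub>R D (m + i)) (m + i) s' \<in> \<T>"
      using S S' by (auto simp: side_at_def C_def)
    have "tri (p - t *\<^sub>R D m) m s = tri (p - t' *\<^sub>R D (m + i)) (m + i) s'"
      using tile_germ_eqI[OF t(4,8), of p "D (m + i) + D (m + i + 1)"]
        tri_germ_side[of t s i p m] tri_germ_side[of t' s' 0 p "m + i"] t i by auto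
    then have "p - t' *\<^sub>R D (m + i) \<in> tri (p - t *\<^sub>R D m) m s" using tri_corner t by metis
    then show False using tri_not_before_side[OF t(1,2,5) i] by blast
  qed
qed

section \<open>The mesh contains every tile; side lengths and periods\<close>

lemma mesh_cong: "k mod 6 = k' mod 6 \<Longrightarrow> mesh k\<^sub>0 l x p k \<longleftrightarrow> mesh k\<^sub>0 l x p k'"
proof -
  assume *: "k mod 6 = k' mod 6"
  then have "even (k - k')" using dvd_trans[of 2 6 "k - k'"] by (simp add: mod_eq_dvd_iff)
  then have "even (k - k\<^sub>0) \<longleftrightarrow> even (k' - k\<^sub>0)" by auto
  then show ?thesis unfolding mesh_def large_cong[OF *] by simp
qed

text \<open>Turning the tile raises the direction of its large corner by 2 each time. The parity
  built into \<open>mesh\<close> leaves a distance of 0, 2 or 4 to \<open>k\<^sub>0\<close>, so at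
  most two turns suffice.\<close>

lemma mesh_tile_normal:
  assumes "C q j s" "mesh k\<^sub>0 l x q (j + i)" "i \<in> {0, 1, 5}"
  obtains p where "mesh k\<^sub>0 l x p k\<^sub>0"
    "tri q j s \<in> {tri p k\<^sub>0 l, tri p (k\<^sub>0 + 5) x, tri p (k\<^sub>0 + 1) (l - x)}"
proof -
  note result = that
  have final: thesis if c: "C q' j' s" and m: "mesh k\<^sub>0 l x q' (j' + i)" and eq: "(j' + i) mod 6 = k\<^sub>0 mod 6"
    and tri: "tri q' j' s = tri q j s" for q' j'
  proof -
    have m': "mesh k\<^sub>0 l x q' k\<^sub>0" using m mesh_cong[OF eq] by blast
    note h = mesh_corners[OF m']
    have eq': "(j' + i + n) mod 6 = (k\<^sub>0 + n) mod 6" for n using eq by (metis mod_add_left_eq)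
    consider "i = 0" | "i = 1" | "i = 5" using assms(3) by auto
    then show thesis
    proof cases
      case 1
      then have "C q' k\<^sub>0 s" using c C_mod[OF eq] by simp
      then have "tri q' j' s = tri q' k\<^sub>0 l" using h(1) size_unique tri_mod[OF eq] 1 by force
      then show thesis using result[OF m'] tri by auto
    next
      case 2
      have e: "j' mod 6 = (k\<^sub>0 + 5) mod 6" using eq'[of 5] 2 by simp
      then have "C q' (k\<^sub>0 + 5) s" using c C_mod[OF e] by simp
      then have "tri q' j' s = tri q' (k\<^sub>0 + 5) x" using h(2) size_unique tri_mod[OF e] by force
      then show thesis using result[OF m'] tri by auto
    next
      case 3
      have e: "j' mod 6 = (k\<^sub>0 + 1) mod 6" using eq'[of 1] 3 by simp
      then have "C q' (k\<^sub>0 + 1) s" using c C_mod[OF e] by simp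
      then have "tri q' j' s = tri q' (k\<^sub>0 + 1) (l - x)" using h(3) size_unique tri_mod[OF e] by force
      then show thesis using result[OF m'] tri by auto
    qed
  qed
  define r where "r = (k\<^sub>0 - (j + i)) mod 6"
  have "even (k\<^sub>0 - (j + i))" using assms(2) by (auto simp: mesh_def)
  then have "even r" unfolding r_def by (rule dvd_mod) simp
  moreover have "0 \<le> r" "r < 6" by (simp_all add: r_def)
  ultimately have "r = 0 \<or> r = 2 \<or> r = 4" by presburger
  moreover have r: "(j + i + r) mod 6 = k\<^sub>0 mod 6" by (simp add: r_def mod_simps)
  note 1 = rotate[OF assms(1)] and 2 = tile_rotate[OF assms]
  note 3 = rotate[OF 1] and 4 = tile_rotate[OF 1 2 assms(3)]
  ultimately show thesis
  proof (elim disjE)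
    assume "r = 0"
    then show thesis using final[OF assms(1,2)] r by simp
  next
    assume "r = 2"
    then show thesis using final[OF 1 2] r by (simp add: tri_rotate algebra_simps)
  next
    assume "r = 4"
    have "tri (q + s *\<^sub>R D j + s *\<^sub>R D (j + 2)) (j + 2 + 2) s = tri q j s"
      by (simp only: tri_rotate)
    then show thesis using final[OF 3 4] r \<open>r = 4\<close> by (simp add: ac_simps)
  qed
qed

lemma mesh_tiles:
  assumes "mesh k\<^sub>0 l x p k\<^sub>0"
  shows "tri p k\<^sub>0 l \<in> \<T>" "tri p (k\<^sub>0 + 5) x \<in> \<T>" "tri p (k\<^sub>0 + 1) (l - x) \<in> \<T>"
  using mesh_corners[OF assms] by (simp_all add: C_def)

text \<open>The tiles having some role in the mesh form a nonempty family closed under contacts by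
  \<open>mesh_contact\<close>; hence \<open>all_tiles\<close> applies.\<close>

lemma all_tiles_in_mesh:
  assumes p: "mesh k\<^sub>0 l x p k\<^sub>0" and T: "T \<in> \<T>"
  obtains q where "mesh k\<^sub>0 l x q k\<^sub>0" "T \<in> {tri q k\<^sub>0 l, tri q (k\<^sub>0 + 5) x, tri q (k\<^sub>0 + 1) (l - x)}"
proof -
  define \<S> where "\<S> = {T. \<exists>q j s i. C q j s \<and> mesh k\<^sub>0 l x q (j + i) \<and> i \<in> {0, 1, 5} \<and> T = tri q j s}"
  have "\<S> = \<T>"
  proof (rule all_tiles)
    show "\<S> \<subseteq> \<T>" by (auto simp: \<S>_def C_def)
    have "tri p k\<^sub>0 l \<in> \<S>" unfolding \<S>_def using p mesh_corners(1)[OF p]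
      by (intro CollectI exI[of _ p] exI[of _ k\<^sub>0] exI[of _ l] exI[of _ 0]) simp
    then show "\<S> \<noteq> {}" by blast
    fix A B z assume A: "A \<in> \<S>" and B: "B \<in> \<T>" and z: "z \<in> A" "z \<in> B" "z \<notin> corners"
    show "B \<in> \<S>"
    proof (cases "A = B")
      case True then show ?thesis using A by simp
    next
      case False
      have AT: "A \<in> \<T>" using A by (auto simp: \<S>_def C_def)
      have nA: "z \<notin> interior A" "z \<notin> interior B" using tile_interior_eqI AT B z False by blast+
      obtain q j s i where q: "C q j s" "mesh k\<^sub>0 l x q (j + i)" "i \<in> {0, 1, 5}" "A = tri q j s"
        using A by (auto simp: \<S>_def)
      note r = rotate[OF q(1)] tile_rotate[OF q(1-3)]
      note r2 = rotate[OF r(1)] tile_rotate[OF r q(3)]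
      have r2': "q + s *\<^sub>R D j + s *\<^sub>R D (j + 2) = q + s *\<^sub>R D (j + 1)" by (simp add: D_simps algebra_simps)
      have mesh': "C q' j' s \<and> mesh k\<^sub>0 l x q' (j' + i)"
        if "(q', j') \<in> {(q, j), (q + s *\<^sub>R D j, j + 2), (q + s *\<^sub>R D (j + 1), j + 4)}" for q' j'
        using that q(1,2) r r2 unfolding r2' by (auto simp: int_num_commute)
      have s: "0 < s" using q(1) by (simp add: C_def)
      obtain q' m t where m: "C q' m s" "mesh k\<^sub>0 l x q' (m + i)" "z = q' + t *\<^sub>R D m" "0 < t" "t < s"
        and A': "tri q' m s = A"
      proof (rule tri_boundary_cases[OF s z(1)[unfolded q(4)]])
        fix q' j' assume "(q', j') \<in> {(q, j), (q + s *\<^sub>R D j, j + 2), (q + s *\<^sub>R D (j + 1), j + 4)}" "z = q'"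
        then show thesis using tri_in_corners mesh' z by blast
      next
        fix q' j' t assume "(q', j') \<in> {(q, j), (q + s *\<^sub>R D j, j + 2), (q + s *\<^sub>R D (j + 1), j + 4)}"
          "tri q' j' s = tri q j s" "z = q' + t *\<^sub>R D j'" "0 < t" "t < s"
        then show thesis using mesh' that q(4) by blast
      qed (use nA q in auto)
      obtain b n s' where b: "C b n s'" "B = tri b n s'" using tile_oriented[OF B] .
      have s': "0 < s'" using b(1) by (simp add: C_def)
      obtain b' n' t' where n: "tri b' n' s' = B" "z = b' + t' *\<^sub>R D n'" "0 < t'" "t' < s'"
      proof (rule tri_boundary_cases[OF s' z(2)[unfolded b(2)]])
        fix b' n' assume "tri b' n' s' = tri b n s'" "z = b'"
        then show thesis using tri_in_corners[of b' n' s'] B b z s' by (auto simp: C_def)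
      qed (use nA b that in auto)
      \<comment> \<open>The angle between the two sides through \<open>z\<close> in units of 60
        degrees. Everything but opposite directions would make the tiles equal or
        overlapping.\<close>
      define d where "d = (n' - m) mod 6"
      have d6: "n' mod 6 = (m + d) mod 6" by (simp add: d_def mod_simps)
      have zA: "S z m t s" using m by (simp add: side_at_def)
      have zB: "S z (m + d) t' s'"
        using n B s' tri_mod[OF d6] D_mod[OF d6] by (simp add: side_at_def C_def)
      have "d \<in> {0, 1, 2, 3, 4, 5}"
        using pos_mod_bound[of 6 "n' - m"] pos_mod_sign[of 6 "n' - m"] unfolding d_def by auto
      then consider "d = 0" | "d \<in> {1, 2}" | "d = 3" | "d = 4" | "d = 5" by auto
      then have d: "d = 3"
      proof cases
        case 1
        then have "t' = t" "s' = s" using side_unique[OF zA] zB by auto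
        moreover have "z - t *\<^sub>R D m = q'" using m by simp
        moreover have "D n' = D m" using D_mod[OF d6] 1 by simp
        then have "z - t' *\<^sub>R D m = b'" using n by simp
        ultimately have "q' = b'" by simp
        then have "A = B" using A' n(1) tri_mod[OF d6] 1 \<open>s' = s\<close> by simp
        then show ?thesis using False by blast
      next
        case 2
        then show ?thesis using side_not_side[OF zA 2] zB by blast
      next
        case 4
        then show ?thesis using side_not_side[OF zB, of 2] zA by (simp add: hex_simps)
      next
        case 5
        then show ?thesis using side_not_side[OF zB, of 1] zA by (simp add: hex_simps)
      qed
      have zz: "z - t *\<^sub>R D m = q'" using m by simp
      obtain i' where i': "i' \<in> {0, 1, 5}" "mesh k\<^sub>0 l x (z - t' *\<^sub>R D (m + 3)) (m + 3 + i')"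
        using mesh_contact[OF m(2)[folded zz] q(3) zA zB[unfolded d]] by blast
      have "z - t' *\<^sub>R D (m + 3) = b'" using n(2) D_mod[OF d6] d by simp
      moreover have "tri b' (m + 3) s' = B" using n(1) tri_mod[OF d6] d by simp
      ultimately show ?thesis unfolding \<S>_def using i' B s'
        by (intro CollectI exI[of _ b'] exI[of _ "m + 3"] exI[of _ s'] exI[of _ i']) (auto simp: C_def)
    qed
  qed
  then have "T \<in> \<S>" using T by simp
  then obtain q j s i where "C q j s" "mesh k\<^sub>0 l x q (j + i)" "i \<in> {0, 1, 5}" "T = tri q j s"
    unfolding \<S>_def by blast
  then show thesis using mesh_tile_normal[of q j s k\<^sub>0 l x i] that by metis
qed

lemma side_lengths_tri:
  assumes "C q j s"
  shows "closed_segment a b edge_of tri q j s \<Longrightarrow> dist a b = s * norm e" "s * norm e \<in> side_lengths \<T>"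
proof -
  have s: "0 < s" and T: "tri q j s \<in> \<T>" using assms by (simp_all add: C_def)
  show "dist a b = s * norm e" if "closed_segment a b edge_of tri q j s"
    using triangle_edge_length[OF tri_frame[OF s] that[unfolded tri_def]] s by (simp add: norm_D)
  have "closed_segment q (q + s *\<^sub>R D j) edge_of tri q j s"
    unfolding tri_def by (rule triangle_edge[OF tri_frame[OF s]])
  then have "dist q (q + s *\<^sub>R D j) \<in> side_lengths \<T>" unfolding side_lengths_def using T by blast
  then show "s * norm e \<in> side_lengths \<T>" using s by (simp add: dist_norm norm_D)
qed

theorem three_sides_and_periodic:
  "(\<exists>a b c. a = b + c \<and> side_lengths \<T> = {a, b, c}) \<and> periodic \<T>"
proof -
  obtain p\<^sub>0 where "triangle p\<^sub>0 e f \<in> \<T>" using base_tile by blast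
  then have "C p\<^sub>0 0 1" by (simp add: C_def tri_def D_def hexdir_def)
  then obtain p k l x z where large: "large p k l x z" by (rule large_exists)
  then have p: "mesh k l x p k" using large_rigid(1)[OF large] by (simp add: mesh_def)
  note c = mesh_corners[OF p]
  note cover = all_tiles_in_mesh[OF p]
  have "side_lengths \<T> = {l * norm e, x * norm e, (l - x) * norm e}"
  proof
    show "{l * norm e, x * norm e, (l - x) * norm e} \<subseteq> side_lengths \<T>"
      using side_lengths_tri(2) c(1-3) by blast
    show "side_lengths \<T> \<subseteq> {l * norm e, x * norm e, (l - x) * norm e}"
    proof
      fix r assume "r \<in> side_lengths \<T>"
      then obtain a b T where T: "r = dist a b" "T \<in> \<T>" "closed_segment a b edge_of T"
        unfolding side_lengths_def by blast
      obtain q where q: "mesh k l x q k" "T \<in> {tri q k l, tri q (k + 5) x, tri q (k + 1) (l - x)}"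
        using cover[OF T(2)] .
      then show "r \<in> {l * norm e, x * norm e, (l - x) * norm e}"
        using side_lengths_tri(1) mesh_corners(1-3)[OF q(1)] T by blast
    qed
  qed
  moreover have "l * norm e = x * norm e + (l - x) * norm e" by (simp add: algebra_simps)
  ultimately have sides: "\<exists>a b c. a = b + c \<and> side_lengths \<T> = {a, b, c}" by blast
  define u where "u = (l - x) *\<^sub>R D k + x *\<^sub>R D (k + 1)"
  define v where "v = l *\<^sub>R D (k + 1) - x *\<^sub>R D k"
  have tri_translate: "(+) w ` tri q j s = tri (q + w) j s" for w q j s
    by (simp add: tri_def triangle_translate)
  \<comment> \<open>The negatives are included because they provide preimages in the proof of
    invariance.\<close>
  have translate: "(+) w ` T \<in> \<T>" if w: "w \<in> {u, - u, v, - v}" and T: "T \<in> \<T>" for w T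
  proof -
    obtain q where q: "mesh k l x q k" "T \<in> {tri q k l, tri q (k + 5) x, tri q (k + 1) (l - x)}"
      using cover[OF T] .
    have "mesh k l x (q + w) k" using mesh_translate[OF q(1), folded u_def v_def] w by auto
    from mesh_tiles[OF this] show ?thesis using q(2) tri_translate by auto
  qed
  have invariant: "(\<lambda>T. (+) w ` T) ` \<T> = \<T>" if w: "w \<in> {u, v}" for w
  proof
    show "(\<lambda>T. (+) w ` T) ` \<T> \<subseteq> \<T>" using translate w by auto
    show "\<T> \<subseteq> (\<lambda>T. (+) w ` T) ` \<T>"
    proof
      fix T assume "T \<in> \<T>"
      then have "(+) (- w) ` T \<in> \<T>" using w by (intro translate) auto
      moreover have "T = (+) w ` ((+) (- w) ` T)" by (simp add: image_image)
      ultimately show "T \<in> (\<lambda>T. (+) w ` T) ` \<T>" by blast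
    qed
  qed
  have indep: "a = 0 \<and> b = 0" if "a *\<^sub>R u + b *\<^sub>R v = 0" for a b
  proof -
    have "(a * (l - x) - b * x) *\<^sub>R D k + (a * x + b * l) *\<^sub>R D (k + 1) = 0"
      using that by (simp add: u_def v_def algebra_simps)
    then have e1: "a * (l - x) = b * x" and e2: "b * l = - (a * x)"
      using equi_frame_zero[OF equi_frame_D] by fastforce+
    \<comment> \<open>The factor is the determinant of \<open>u\<close> and \<open>v\<close> in the
      basis \<open>D k\<close>, \<open>D (k + 1)\<close>; it is positive as
      \<open>0 < x < l\<close>.\<close>
    have "a * ((l - x) * l + x * x) = a * (l - x) * l + a * x * x" by (simp add: algebra_simps)
    also have "\<dots> = (b * l) * x + a * x * x" unfolding e1 by simp
    also have "\<dots> = 0" unfolding e2 by simp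
    finally have "a * ((l - x) * l + x * x) = 0" .
    moreover have "(l - x) * l > 0" "x * x > 0" using c(4,5) by simp_all
    ultimately have "a = 0" by simp
    then show ?thesis using e2 c(4,5) by simp
  qed
  have uv: "u \<noteq> v" using indep[of 1 "- 1"] by auto
  have "independent {u, v}"
  proof (rule independent_if_scalars_zero)
    fix f y assume f: "(\<Sum>y\<in>{u, v}. f y *\<^sub>R y) = 0" "y \<in> {u, v}"
    then have "f u *\<^sub>R u + f v *\<^sub>R v = 0" using uv by simp
    from indep[OF this] show "f y = 0" using f(2) by auto
  qed simp
  then have "periodic \<T>" unfolding periodic_def using uv invariant by blast
  with sides show ?thesis by blast
qed

end

theorem theorem3:
  fixes \<T> :: "(real^2) set set"
  assumes "tiles \<T> UNIV"
    and "\<And>T. T \<in> \<T> \<Longrightarrow> equilateral_triangle T"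
    and "\<exists>\<delta>>0. \<forall>l\<in>side_lengths \<T>. \<delta> \<le> l"
    and "\<And>S T. S \<in> \<T> \<Longrightarrow> T \<in> \<T> \<Longrightarrow> S \<noteq> T \<Longrightarrow> \<not> share_side S T"
  shows "(\<exists>a b c. a = b + c \<and> side_lengths \<T> = {a, b, c}) \<and> periodic \<T>"
proof -
  obtain \<delta> where \<delta>: "\<delta> > 0" "\<And>l. l \<in> side_lengths \<T> \<Longrightarrow> \<delta> \<le> l" using assms(3) by blast
  interpret equilateral_tiling \<T> \<delta>
    by unfold_locales (use assms \<delta> in auto)
  have "0 \<in> \<Union>\<T>" using assms(1) by (simp add: tiles_def)
  then obtain T where "T \<in> \<T>" by blast
  then obtain p e f where "equi_frame e f" "triangle p e f \<in> \<T>" using tile_frame by metis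
  then interpret oriented_tiling \<T> \<delta> e f by unfold_locales auto
  show ?thesis by (rule three_sides_and_periodic)
qed

end
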